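(* Let $P$ be a rational polytope in $\mathbb{R}^N$ with denominator $d$, and let $L(P,t)$ and $L(\mathring{P},t)$, $t\in\mathbb{R}$, be its real Ehrhart quasi-polynomials, i.e. $L(P,t)=\sum_{k=0}^{\dim P}c_k(P,t)t^k$ and $L(\mathring P,t)=\sum_{k=0}^{\dim P}c_k(\mathring P,t)t^k$ with $d$-periodic coefficient functions defined on $\mathbb{R}$ such that $L(P,t)=\#(tP\cap\mathbb{Z}^N)$ for $t\ge 0$ and $L(\mathring{P},t)=\#(t\mathring{P}\cap\mathbb{Z}^N)$ for $t>0$ (the coefficients being obtained, for a decomposition of $P$ into disjoint relatively open rational simplices $\mathring\sigma_i$, as $c_k(P,t)=\sum_{\dim\sigma_i\ge k}c_k(\mathring\sigma_i,t)$, and analogously for $\mathring P$ using the simplices not contained in $\partial P$). Then \[ L(\mathring{P},-t)=(-1)^{\dim P}L(P,t)\quad\text{for all } t\in\mathbb{R}. \]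
   Context: $\mathring{P}$ is the relative interior of $P$. The denominator $d$ of a rational polytope $P$ is the smallest positive real number with $dP$ integral. For a rational $n$-simplex $\sigma$ with vertices $\alpha_0,\dots,\alpha_n$ and denominator $d$, $c_k(\mathring\sigma,t)=\frac{1}{n!d^k}\sum_{j=1}^{n+1}\#\bar D(\sigma,dj+d\langle t/d\rangle)\,s_{n-k}(1-j-\langle t/d\rangle,\dots,n-j-\langle t/d\rangle)$, where $\langle x\rangle=x-\lceil x\rceil$, $s_j$ is the $j$-th elementary symmetric polynomial in $n$ variables, and $\bar D(\sigma,\ell)=\{\sum_{j=0}^n v_j\alpha_j\in\mathbb{Z}^N:0<v_j\le d,\ \sum_jv_j=\ell\}$. *)

theory Defs
  imports "HOL-Analysis.Analysis"
begin

definition int_lattice :: "(real^'n) set" where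
  "int_lattice = {x. \<forall>i. x $ i \<in> \<int>}"

definition rational_polytope :: "(real^'n) set \<Rightarrow> bool" where
  "rational_polytope P \<longleftrightarrow>
     polytope P \<and> P \<noteq> {} \<and> (\<forall>x. x extreme_point_of P \<longrightarrow> (\<forall>i. x $ i \<in> \<rat>))"

definition integral_polytope :: "(real^'n) set \<Rightarrow> bool" where
  "integral_polytope P \<longleftrightarrow> polytope P \<and> P \<noteq> {} \<and> (\<forall>x. x extreme_point_of P \<longrightarrow> x \<in> int_lattice)"

text \<open>Every positive dilate of the polytope \<open>{0}\<close> is integral, so it has no smallest dilation
  factor. It still has to be treated, since \<open>{0}\<close> may occur as a simplex of a decomposition; any
  positive value would yield the same \<open>simplex_coeff\<close>.\<close>

definition polytope_denominator :: "(real^'n) set \<Rightarrow> real" where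
  "polytope_denominator P =
     (if P = {0} then 1 else (LEAST d. 0 < d \<and> integral_polytope ((\<lambda>x. d *\<^sub>R x) ` P)))"

definition rational_simplex :: "(real^'n) set \<Rightarrow> bool" where
  "rational_simplex \<sigma> \<longleftrightarrow> rational_polytope \<sigma> \<and> (\<exists>n. n simplex \<sigma>)"

definition neg_frac :: "real \<Rightarrow> real" where
  "neg_frac x = x - of_int \<lceil>x\<rceil>"

definition elem_sym :: "nat \<Rightarrow> nat \<Rightarrow> (nat \<Rightarrow> real) \<Rightarrow> real" where
  "elem_sym n j x = (\<Sum>S | S \<subseteq> {1..n} \<and> card S = j. \<Prod>i\<in>S. x i)"

text \<open>The vertices of a simplex are its extreme points, so the weights \<open>v\<close> are indexed by the
  vertices themselves.\<close>

definition D_bar :: "(real^'n) set \<Rightarrow> real \<Rightarrow> (real^'n) set" where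
  "D_bar \<sigma> l =
     {\<Sum>a | a extreme_point_of \<sigma>. v a *\<^sub>R a | v.
        (\<forall>a. a extreme_point_of \<sigma> \<longrightarrow> 0 < v a \<and> v a \<le> polytope_denominator \<sigma>) \<and>
        (\<Sum>a | a extreme_point_of \<sigma>. v a) = l} \<inter> int_lattice"

definition simplex_coeff :: "(real^'n) set \<Rightarrow> nat \<Rightarrow> real \<Rightarrow> real" where
  "simplex_coeff \<sigma> k t =
     (let n = nat (aff_dim \<sigma>); d = polytope_denominator \<sigma>; r = neg_frac (t / d) in
        1 / (fact n * d ^ k) *
        (\<Sum>j = 1..n + 1. real (card (D_bar \<sigma> (d * real j + d * r))) *
                         elem_sym n (n - k) (\<lambda>i. real i - real j - r)))"

definition open_simplex_decomposition :: "(real^'n) set set \<Rightarrow> (real^'n) set \<Rightarrow> bool" where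
  "open_simplex_decomposition T P \<longleftrightarrow>
     finite T \<and> (\<forall>\<sigma>\<in>T. rational_simplex \<sigma>) \<and>
     disjoint_family_on rel_interior T \<and> (\<Union>\<sigma>\<in>T. rel_interior \<sigma>) = P"

definition ehrhart_coeff :: "(real^'n) set set \<Rightarrow> nat \<Rightarrow> real \<Rightarrow> real" where
  "ehrhart_coeff T k t = (\<Sum>\<sigma> | \<sigma> \<in> T \<and> int k \<le> aff_dim \<sigma>. simplex_coeff \<sigma> k t)"

definition ehrhart_coeff_int ::
    "(real^'n) set \<Rightarrow> (real^'n) set set \<Rightarrow> nat \<Rightarrow> real \<Rightarrow> real" where
  "ehrhart_coeff_int P T k t = ehrhart_coeff {\<sigma> \<in> T. \<not> \<sigma> \<subseteq> rel_frontier P} k t"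

definition ehrhart :: "(real^'n) set \<Rightarrow> (real^'n) set set \<Rightarrow> real \<Rightarrow> real" where
  "ehrhart P T t = (\<Sum>k = 0..nat (aff_dim P). ehrhart_coeff T k t * t ^ k)"

definition ehrhart_int :: "(real^'n) set \<Rightarrow> (real^'n) set set \<Rightarrow> real \<Rightarrow> real" where
  "ehrhart_int P T t = (\<Sum>k = 0..nat (aff_dim P). ehrhart_coeff_int P T k t * t ^ k)"

end

theory Submission
  imports Defs
begin

text \<open>For an open rational simplex, the division with remainder \<open>v = d u + w\<close>, \<open>0 < w \<le> d\<close>, of the
  vertex weights of a lattice point turns the coefficient formula into a count of points of \<open>t \<sigma>\<close>
  with positive weights; dividing as \<open>v = d u + (d - w)\<close> instead shows that the same expression at
  \<open>-t\<close> counts, up to the sign \<open>(-1)\<^bsup>dim \<sigma>\<^esup>\<close>, the points with nonnegative weights. Summing over the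
  cells in the interior of \<open>P\<close>, a point \<open>x\<close> of \<open>t P\<close> is counted with multiplicity
  \<open>\<Sum>(-1)\<^bsup>dim \<sigma>\<^esup>\<close> over the closed cells containing \<open>x / t\<close>, which is \<open>(-1)\<^bsup>dim P\<^esup>\<close> by Euler's
  relation in a small ball. This settles \<open>t > 0\<close>; since the coefficients have a common period, the
  identity extends to all \<open>t\<close> as an identity of polynomials along \<open>t + m D\<close>. For the same reason the
  coefficients do not depend on the decomposition, and a triangulation whose vertices are those of
  \<open>P\<close> shows that the denominator of \<open>P\<close> is a period.\<close>

section \<open>Euler's relation for relatively open convex cells\<close>

text \<open>The cells need not fit together face to face: only their relative interiors are
  disjoint, and a cell may touch others along part of a side. No face lattice with Moebius inversion
  is at hand, so Euler's relation is proved for arbitrary finite linear relations between indicators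
  of bounded, relatively open convex sets. The value t = 0 stands apart. All cells shrink to the
  origin, so they are no longer disjoint and the point x / t does not exist; a global form of
  Euler's relation yields (-1)^dim P for the interior, and reciprocity at 0 then yields 1 for P. A
  vertex of the given decomposition may lie anywhere in P, so its denominator need not divide that
  of P. Arguments with this decomposition use a common denominator of all its vertices as period;
  the denominator of P enters only through a second decomposition without new vertices. In the cell
  formula \<open>neg_frac\<close> takes values in (-1, 0], which matches remainders in (0, d] and
  produces the index range 1, ..., n + 1 for both signs of the argument.\<close>

definition open_cell_sign :: "'a::euclidean_space set \<Rightarrow> real" where
  "open_cell_sign C = (if C = {} then 0 else (- 1) ^ nat (aff_dim C))"

lemma rel_open_Int_open:
  fixes C :: "'a::euclidean_space set"
  assumes "convex C" "rel_open C" "open U"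
  shows "rel_open (C \<inter> U)"
proof (cases "C \<inter> U = {}")
  case False
  then have "affine hull (C \<inter> U) = affine hull C"
    using assms affine_hull_convex_Int_open by blast
  moreover have "openin (top_of_set (affine hull C)) (C \<inter> U)"
    using assms(2,3) unfolding rel_open by (rule openin_Int_open)
  ultimately show ?thesis by (simp add: rel_open)
qed (simp add: rel_open_def)

lemma rel_open_Int_hyperplane:
  fixes C :: "'a::euclidean_space set"
  assumes "convex C" "rel_open C" "C \<inter> {x. a \<bullet> x = b} \<noteq> {}"
  shows "rel_open (C \<inter> {x. a \<bullet> x = b})"
  using convex_affine_rel_interior_Int[OF assms(1) affine_hyperplane, of a b] assms
  by (simp add: rel_open_def)

text \<open>A relatively open set is an open piece of its affine hull, so the slice is an open piece
  of the hyperplane section of that hull and spans all of this section.\<close>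

lemma aff_dim_rel_open_Int_hyperplane:
  fixes C :: "'a::euclidean_space set"
  assumes "rel_open C" and ne: "C \<inter> {x. a \<bullet> x = b} \<noteq> {}" and nsub: "\<not> C \<subseteq> {x. a \<bullet> x = b}"
  shows "aff_dim (C \<inter> {x. a \<bullet> x = b}) = aff_dim C - 1"
proof -
  let ?H = "{x. a \<bullet> x = b}"
  obtain U where U: "open U" "affine hull C \<inter> U = C"
    using assms(1) unfolding rel_open openin_open by metis
  have eq: "affine hull C \<inter> ?H \<inter> U = C \<inter> ?H" using U(2) by blast
  have "affine hull (affine hull C \<inter> ?H \<inter> U) = affine hull (affine hull C \<inter> ?H)"
    using U(1) ne eq by (intro affine_hull_affine_Int_open affine_Int affine_hyperplane) auto
  from arg_cong[where f = aff_dim, OF this]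
  have "aff_dim (affine hull C \<inter> ?H \<inter> U) = aff_dim (affine hull C \<inter> ?H)"
    by (simp only: aff_dim_affine_hull)
  moreover note eq
  moreover have "aff_dim (affine hull C \<inter> ?H) = aff_dim (affine hull C) - 1"
    using ne nsub hull_subset[of C affine]
    by (subst aff_dim_affine_Int_hyperplane) (auto intro: affine_affine_hull)
  ultimately show ?thesis by (simp only: aff_dim_affine_hull)
qed

text \<open>The sign is the Euler characteristic with compact support of a relatively open cell. A
  proper slice loses exactly one dimension, which changes the parity.\<close>

lemma open_cell_sign_slice:
  fixes C :: "'a::euclidean_space set"
  assumes "convex C" "rel_open C" "C \<inter> {x. a \<bullet> x = b} \<noteq> {}" "\<not> C \<subseteq> {x. a \<bullet> x = b}"
  shows "open_cell_sign (C \<inter> {x. a \<bullet> x = b}) = - open_cell_sign C"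
proof -
  have d: "aff_dim (C \<inter> {x. a \<bullet> x = b}) = aff_dim C - 1"
    using assms aff_dim_rel_open_Int_hyperplane by blast
  have "aff_dim (C \<inter> {x. a \<bullet> x = b}) \<ge> 0"
    using assms(3) by (metis aff_dim_negative_iff not_less)
  then have "nat (aff_dim C) = Suc (nat (aff_dim (C \<inter> {x. a \<bullet> x = b})))"
    using d by linarith
  then show ?thesis using assms(3) by (auto simp: open_cell_sign_def)
qed

lemma bounded_rel_open_interval_cases:
  fixes J :: "real set"
  assumes "convex J" "rel_open J" "bounded J" "J \<noteq> {}"
  obtains (point) p where "J = {p}" | (interval) a b where "a < b" "J = {a<..<b}"
proof (cases "\<exists>p. J = {p}")
  case False
  then obtain x y where xy: "x \<in> J" "y \<in> J" "x < y"
    using \<open>J \<noteq> {}\<close> by (metis is_singletonI' is_singleton_def linorder_neqE)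
  have "aff_dim J = 1"
  proof -
    have "aff_dim J \<noteq> 0" using False by (simp add: aff_dim_eq_0)
    moreover have "aff_dim J \<ge> 0" using \<open>J \<noteq> {}\<close> by (metis aff_dim_negative_iff not_less)
    moreover have "aff_dim J \<le> 1" using aff_dim_le_DIM[of J] by simp
    ultimately show ?thesis by linarith
  qed
  then have "affine hull J = UNIV"
    using aff_dim_eq_full[of J] by simp
  then have op: "open J" using \<open>rel_open J\<close> by (simp add: rel_open)
  have bd: "bdd_above J" "bdd_below J" using assms bounded_imp_bdd_above bounded_imp_bdd_below by auto
  have "J = {Inf J<..<Sup J}"
  proof (intro equalityI subsetI)
    fix z assume z: "z \<in> J"
    then obtain e where e: "e > 0" "cball z e \<subseteq> J" using op open_contains_cball by blast
    then have "z - e \<in> J" "z + e \<in> J" by (auto simp: subset_iff dist_real_def)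
    then show "z \<in> {Inf J<..<Sup J}"
      using cInf_lower[OF _ bd(2), of "z - e"] cSup_upper[OF _ bd(1), of "z + e"] e by auto
  next
    fix z assume z: "z \<in> {Inf J<..<Sup J}"
    then obtain u v where uv: "u \<in> J" "u < z" "v \<in> J" "z < v"
      using cInf_lessD[of J z] less_cSupD[of J z] \<open>J \<noteq> {}\<close> by auto
    have "is_interval J" using assms(1) by (simp add: is_interval_convex_1)
    then show "z \<in> J" using uv unfolding is_interval_1 by (meson less_imp_le)
  qed
  moreover have "Inf J < Sup J"
    using cInf_lower[OF xy(1) bd(2)] cSup_upper[OF xy(2) bd(1)] xy(3) by linarith
  ultimately show ?thesis using interval by blast
qed (use point in blast)

text \<open>The functional \<open>f \<mapsto> \<Sum>\<^sub>s (f s - f (s+))\<close> maps the indicator of a point to \<open>1\<close> and that of an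
  open interval to \<open>-1\<close>.\<close>

lemma one_dim_euler_relation:
  fixes J :: "'i \<Rightarrow> real set" and c :: "'i \<Rightarrow> real"
  assumes "finite I"
    and J: "\<And>i. i \<in> I \<Longrightarrow> (\<exists>p. J i = {p} \<and> e i = 1) \<or> (\<exists>a b. a < b \<and> J i = {a<..<b} \<and> e i = - 1)"
    and zero: "\<And>s. (\<Sum>i\<in>I. c i * e i * indicator (J i) s) = 0"
  shows "(\<Sum>i\<in>I. c i) = 0"
proof -
  have "\<forall>i\<in>I. \<exists>E. finite E \<and> ((\<exists>p. J i = {p} \<and> E = {p}) \<or> (\<exists>a b. a < b \<and> J i = {a<..<b} \<and> E = {a, b}))"
  proof
    fix i assume "i \<in> I"
    from J[OF this] show "\<exists>E. finite E \<and> ((\<exists>p. J i = {p} \<and> E = {p}) \<or> (\<exists>a b. a < b \<and> J i = {a<..<b} \<and> E = {a, b}))"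
    proof (elim disjE exE conjE)
      fix p assume "J i = {p}"
      then show ?thesis by (intro exI[of _ "{p}"]) simp
    next
      fix a b :: real assume "a < b" "J i = {a<..<b}"
      then show ?thesis by (intro exI[of _ "{a, b}"]) blast
    qed
  qed
  from bchoice[OF this] obtain A where
    A: "\<And>i. i \<in> I \<Longrightarrow> finite (A i) \<and> ((\<exists>p. J i = {p} \<and> A i = {p}) \<or> (\<exists>a b. a < b \<and> J i = {a<..<b} \<and> A i = {a, b}))"
    by blast
  define E where "E = (\<Union>i\<in>I. A i)"
  have finE: "finite E" using A assms(1) by (auto simp: E_def)
  define D where "D = {y - x | x y. x \<in> E \<and> y \<in> E \<and> x < y}"
  have "finite D"
  proof (rule finite_subset)
    show "D \<subseteq> (\<lambda>(x,y). y - x) ` (E \<times> E)" by (auto simp: D_def)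
  qed (use finE in auto)
  \<comment> \<open>At most half the smallest gap between endpoints, so that
    \<open>s + \<epsilon>\<close> serves as the right-hand limit at all \<open>s\<close> in
    \<open>E\<close> at once; the inserted 1 covers an empty set of gaps.\<close>
  define \<epsilon> where "\<epsilon> = Min (insert 1 D) / 2"
  have eps: "\<epsilon> > 0" "\<And>x y. \<lbrakk>x \<in> E; y \<in> E; x < y\<rbrakk> \<Longrightarrow> x + \<epsilon> < y"
  proof -
    have pos: "Min (insert 1 D) > 0" using \<open>finite D\<close> by (subst Min_gr_iff) (auto simp: D_def)
    then show "\<epsilon> > 0" by (simp add: \<epsilon>_def)
    fix x y assume "x \<in> E" "y \<in> E" "x < y"
    then have "y - x \<in> insert 1 D" by (auto simp: D_def)
    then have "Min (insert 1 D) \<le> y - x" using \<open>finite D\<close> by (intro Min_le) auto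
    then show "x + \<epsilon> < y" using pos by (simp add: \<epsilon>_def)
  qed
  \<comment> \<open>Only one endpoint contributes: the point itself, or the left end
    \<open>a\<close>, just after which the indicator jumps from 0 to 1. The differences there are 1
    and -1, and \<open>e i\<close> is the same sign.\<close>
  have one: "(\<Sum>s\<in>E. e i * indicator (J i) s - e i * indicator (J i) (s + \<epsilon>)) = 1" if i: "i \<in> I" for i
  proof -
    have sub: "A i \<subseteq> E" using i by (auto simp: E_def)
    consider (p) p where "J i = {p}" "A i = {p}" "e i = 1"
      | (ab) a b where "a < b" "J i = {a<..<b}" "A i = {a,b}" "e i = - 1"
    proof -
      from J[OF i] A[OF i] show ?thesis
      proof (elim disjE exE conjE)
        fix p a b assume "J i = {p}" "(a::real) < b" "J i = {a<..<b}"
        then have "infinite {p}" using infinite_Ioo[of a b] by simp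
        then show ?thesis by simp
      next
        fix p a b assume "J i = {p}" "(a::real) < b" "J i = {a<..<b}"
        then have "infinite {p}" using infinite_Ioo[of a b] by simp
        then show ?thesis by simp
      qed (use p ab in auto)
    qed
    then show ?thesis
    proof cases
      case (p p)
      have "(\<Sum>s\<in>E. e i * indicator (J i) s - e i * indicator (J i) (s + \<epsilon>)) = (\<Sum>s\<in>E. if s = p then 1 else 0)"
      proof (rule sum.cong[OF refl])
        fix s assume s: "s \<in> E"
        have "p \<in> E" using p sub by auto
        then have "s + \<epsilon> \<noteq> p" using eps(2)[OF s, of p] eps(1) by fastforce
        then show "e i * indicator (J i) s - e i * indicator (J i) (s + \<epsilon>) = (if s = p then 1 else 0)"
          using p by (auto simp: indicator_def)
      qed
      then show ?thesis using finE p sub by simp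
    next
      case (ab a b)
      have "(\<Sum>s\<in>E. e i * indicator (J i) s - e i * indicator (J i) (s + \<epsilon>)) = (\<Sum>s\<in>E. if s = a then 1 else 0)"
      proof (rule sum.cong[OF refl])
        fix s assume s: "s \<in> E"
        have E: "a \<in> E" "b \<in> E" using ab sub by auto
        then show "e i * indicator (J i) s - e i * indicator (J i) (s + \<epsilon>) = (if s = a then 1 else 0)"
          using ab eps(1) eps(2)[OF s E(1)] eps(2)[OF s E(2)]
          by (auto simp: indicator_def)
      qed
      then show ?thesis using finE ab sub by simp
    qed
  qed
  have "(\<Sum>i\<in>I. c i) = (\<Sum>i\<in>I. c i * (\<Sum>s\<in>E. e i * indicator (J i) s - e i * indicator (J i) (s + \<epsilon>)))"
    by (intro sum.cong) (auto simp: one)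
  also have "\<dots> = (\<Sum>s\<in>E. (\<Sum>i\<in>I. c i * e i * indicator (J i) s) - (\<Sum>i\<in>I. c i * e i * indicator (J i) (s + \<epsilon>)))"
    by (simp add: sum_distrib_left sum.swap[of _ I E] sum_subtractf[symmetric] algebra_simps)
  also have "\<dots> = 0" by (simp add: zero)
  finally show ?thesis .
qed

text \<open>If the functional is constant on the cell, a slice is the whole cell or empty; otherwise
  every hyperplane of the family that meets the cell cuts it properly and flips the sign. Thus
  \<open>e\<close> is the sign of the projected cell, and the sign is multiplicative along the
  projection.\<close>

lemma open_cell_sign_slice_indicator:
  fixes C :: "'a::euclidean_space set"
  assumes C: "convex C" "rel_open C" "bounded C" "C \<noteq> {}"
  shows "\<exists>e. ((\<exists>p. (\<bullet>) b ` C = {p} \<and> e = 1) \<or> (\<exists>u v. u < v \<and> (\<bullet>) b ` C = {u<..<v} \<and> e = - 1)) \<and>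
    (\<forall>s. open_cell_sign (C \<inter> {x. b \<bullet> x = s}) = open_cell_sign C * e * indicator ((\<bullet>) b ` C) s)"
proof -
  have lin: "linear ((\<bullet>) b)" by (simp add: bounded_linear.linear bounded_linear_inner_right)
  have J: "convex ((\<bullet>) b ` C)" "rel_open ((\<bullet>) b ` C)" "bounded ((\<bullet>) b ` C)" "(\<bullet>) b ` C \<noteq> {}"
    using C rel_interior_convex_linear_image[OF lin C(1)]
    by (auto simp: rel_open_def convex_linear_image[OF lin] bounded_linear_image bounded_linear_inner_right)
  have iff: "s \<in> (\<bullet>) b ` C \<longleftrightarrow> C \<inter> {x. b \<bullet> x = s} \<noteq> {}" for s by auto
  from J show ?thesis
  proof (cases rule: bounded_rel_open_interval_cases)
    case (point p)
    have "open_cell_sign (C \<inter> {x. b \<bullet> x = s}) = open_cell_sign C * 1 * indicator ((\<bullet>) b ` C) s" for s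
    proof (cases "s = p")
      case True
      then have "C \<inter> {x. b \<bullet> x = s} = C" using point by auto
      then show ?thesis using True point by simp
    next
      case False
      then have "C \<inter> {x. b \<bullet> x = s} = {}" using point by auto
      then show ?thesis using False point by (simp add: open_cell_sign_def)
    qed
    with point show ?thesis by (intro exI[of _ 1]) auto
  next
    case (interval u v)
    have "open_cell_sign (C \<inter> {x. b \<bullet> x = s}) = open_cell_sign C * (-1) * indicator ((\<bullet>) b ` C) s" for s
    proof (cases "s \<in> (\<bullet>) b ` C")
      case True
      have "\<not> C \<subseteq> {x. b \<bullet> x = s}"
      proof
        assume "C \<subseteq> {x. b \<bullet> x = s}"
        then have "(\<bullet>) b ` C \<subseteq> {s}" by auto
        then have "finite {u<..<v}" using interval finite_subset[of _ "{s}"] by simp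
        then show False using interval infinite_Ioo by blast
      qed
      then show ?thesis using open_cell_sign_slice[OF C(1,2), of b s] True iff by auto
    next
      case False
      then show ?thesis using iff[of s] by (simp add: open_cell_sign_def)
    qed
    with interval show ?thesis by (intro exI[of _ "- 1"]) auto
  qed
qed

text \<open>A Fubini argument. Slicing in one coordinate direction leaves a relation between the
  slices with one free direction fewer; by induction the signs of the slices cancel at every height,
  and the relation on the line sums this over all heights.\<close>

theorem euler_relation:
  fixes C :: "'i \<Rightarrow> 'a::euclidean_space set" and c :: "'i \<Rightarrow> real"
  assumes "finite I"
    and "\<And>i. i \<in> I \<Longrightarrow> convex (C i) \<and> rel_open (C i) \<and> bounded (C i)"
    and "\<And>x. (\<Sum>i\<in>I. c i * indicator (C i) x) = 0"
  shows "(\<Sum>i\<in>I. c i * open_cell_sign (C i)) = 0"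
proof -
  \<comment> \<open>\<open>B\<close> contains the directions that are still free: each coordinate
    outside \<open>B\<close> has one common value on all cells. The cells are generalized because
    slicing replaces them.\<close>
  have fib: "(\<Sum>i\<in>I. c i * open_cell_sign (C i)) = 0"
    if "finite B" "finite I" "B \<subseteq> Basis"
      and "\<And>i. i \<in> I \<Longrightarrow> convex (C i) \<and> rel_open (C i) \<and> bounded (C i)"
      and "\<And>x. (\<Sum>i\<in>I. c i * indicator (C i) x) = 0"
      and "\<forall>b \<in> Basis - B. \<exists>s. \<forall>i\<in>I. C i \<subseteq> {x. b \<bullet> x = s}"
    for B and C :: "'i \<Rightarrow> 'a::euclidean_space set" and I
    using that
  proof (induction B arbitrary: I C rule: finite_induct)
    case empty
    then have "\<forall>b\<in>Basis. \<exists>s. \<forall>i\<in>I. C i \<subseteq> {x. b \<bullet> x = s}" by simp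
    from bchoice[OF this] obtain f
      where f: "\<And>b i. \<lbrakk>b \<in> Basis; i \<in> I\<rbrakk> \<Longrightarrow> C i \<subseteq> {x. b \<bullet> x = f b}" by blast
    \<comment> \<open>All coordinates are fixed, so every cell is empty or \<open>{p}\<close>, and
      its sign is its indicator at \<open>p\<close>.\<close>
    define p where "p = (\<Sum>b\<in>Basis. f b *\<^sub>R b)"
    have sub: "C i \<subseteq> {p}" if "i \<in> I" for i
    proof
      fix x assume "x \<in> C i"
      then have "x \<bullet> b = p \<bullet> b" if "b \<in> Basis" for b :: 'a
        using f[OF that \<open>i \<in> I\<close>] that by (auto simp: p_def inner_commute[of b])
      then show "x \<in> {p}" by (auto intro: euclidean_eqI)
    qed
    have "open_cell_sign (C i) = indicator (C i) p" if "i \<in> I" for i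
      using sub[OF that] by (auto simp: open_cell_sign_def subset_singleton_iff)
    then show ?case using empty.prems(4)[of p] by (simp cong: sum.cong)
  next
    case (insert b B)
    \<comment> \<open>Empty cells have sign 0 and project neither to a point nor to an
      interval.\<close>
    define I' where "I' = {i \<in> I. C i \<noteq> {}}"
    have fI': "finite I'" using insert.prems(1) by (simp add: I'_def)
    have "\<forall>i\<in>I'. \<exists>e. ((\<exists>p. (\<bullet>) b ` C i = {p} \<and> e = 1) \<or> (\<exists>u v. u < v \<and> (\<bullet>) b ` C i = {u<..<v} \<and> e = - 1)) \<and>
      (\<forall>s. open_cell_sign (C i \<inter> {x. b \<bullet> x = s}) = open_cell_sign (C i) * e * indicator ((\<bullet>) b ` C i) s)"
    proof
      fix i assume "i \<in> I'"
      then have "i \<in> I" "C i \<noteq> {}" by (auto simp: I'_def)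
      with insert.prems(3)[of i] show "\<exists>e. ((\<exists>p. (\<bullet>) b ` C i = {p} \<and> e = 1) \<or> (\<exists>u v. u < v \<and> (\<bullet>) b ` C i = {u<..<v} \<and> e = - 1)) \<and>
      (\<forall>s. open_cell_sign (C i \<inter> {x. b \<bullet> x = s}) = open_cell_sign (C i) * e * indicator ((\<bullet>) b ` C i) s)"
        by (intro open_cell_sign_slice_indicator) simp_all
    qed
    from bchoice[OF this] obtain e :: "'i \<Rightarrow> real" where
      e: "\<forall>i\<in>I'. ((\<exists>p. (\<bullet>) b ` C i = {p} \<and> e i = 1) \<or> (\<exists>u v. u < v \<and> (\<bullet>) b ` C i = {u<..<v} \<and> e i = - 1)) \<and>
      (\<forall>s. open_cell_sign (C i \<inter> {x. b \<bullet> x = s}) = open_cell_sign (C i) * e i * indicator ((\<bullet>) b ` C i) s)"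
      by (rule exE)
    note e1 = conjunct1[OF bspec[OF e]] and e2 = conjunct2[OF bspec[OF e], rule_format]
    \<comment> \<open>The hyperplane fixes the coordinate along \<open>b\<close>, so the slices meet
      the induction condition for \<open>B\<close>.\<close>
    have slice: "(\<Sum>i\<in>I. c i * open_cell_sign (C i \<inter> {x. b \<bullet> x = s})) = 0" for s
    proof (rule insert.IH)
      fix i assume i: "i \<in> I"
      show "convex (C i \<inter> {x. b \<bullet> x = s}) \<and> rel_open (C i \<inter> {x. b \<bullet> x = s}) \<and> bounded (C i \<inter> {x. b \<bullet> x = s})"
        using insert.prems(3)[OF i] rel_open_Int_hyperplane[of "C i" b s]
        by (cases "C i \<inter> {x. b \<bullet> x = s} = {}")
          (simp_all add: rel_open_def convex_Int convex_hyperplane bounded_Int)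
    next
      fix x
      have "(\<Sum>i\<in>I. c i * indicator (C i \<inter> {x. b \<bullet> x = s}) x) = (\<Sum>i\<in>I. c i * indicator (C i) x) * indicator {x. b \<bullet> x = s} x"
        by (simp add: sum_distrib_right indicator_inter_arith mult.assoc)
      then show "(\<Sum>i\<in>I. c i * indicator (C i \<inter> {x. b \<bullet> x = s}) x) = 0"
        by (simp add: insert.prems(4))
    next
      show "\<forall>b'\<in>Basis - B. \<exists>s'. \<forall>i\<in>I. C i \<inter> {x. b \<bullet> x = s} \<subseteq> {x. b' \<bullet> x = s'}"
      proof
        fix b' assume "b' \<in> Basis - B"
        then show "\<exists>s'. \<forall>i\<in>I. C i \<inter> {x. b \<bullet> x = s} \<subseteq> {x. b' \<bullet> x = s'}"
        proof (cases "b' = b")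
          case False
          with \<open>b' \<in> Basis - B\<close> have "b' \<in> Basis - insert b B" by simp
          from bspec[OF insert.prems(5) this] show ?thesis by blast
        qed auto
      qed
    qed (use insert.prems(1,2) in simp_all)
    have "(\<Sum>i\<in>I'. c i * open_cell_sign (C i)) = 0"
    proof (rule one_dim_euler_relation[OF fI', where J = "\<lambda>i. (\<bullet>) b ` C i" and e = e])
      fix s
      have "(\<Sum>i\<in>I'. c i * open_cell_sign (C i) * e i * indicator ((\<bullet>) b ` C i) s)
        = (\<Sum>i\<in>I'. c i * open_cell_sign (C i \<inter> {x. b \<bullet> x = s}))"
        by (intro sum.cong) (simp_all add: e2)
      also have "\<dots> = (\<Sum>i\<in>I. c i * open_cell_sign (C i \<inter> {x. b \<bullet> x = s}))"
        by (rule sum.mono_neutral_left) (use insert.prems(1) in \<open>auto simp: I'_def open_cell_sign_def\<close>)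
      finally show "(\<Sum>i\<in>I'. c i * open_cell_sign (C i) * e i * indicator ((\<bullet>) b ` C i) s) = 0"
        using slice by simp
    qed (rule e1)
    moreover have "(\<Sum>i\<in>I'. c i * open_cell_sign (C i)) = (\<Sum>i\<in>I. c i * open_cell_sign (C i))"
      by (rule sum.mono_neutral_left) (use insert.prems(1) in \<open>auto simp: I'_def open_cell_sign_def\<close>)
    ultimately show ?case by simp
  qed
  show ?thesis by (rule fib[OF finite_Basis assms(1) order_refl assms(2,3)]) simp_all
qed

section \<open>Euler's relation for decompositions of a relative interior\<close>

lemma open_cell_sign_rel_interior_Int_open:
  fixes S :: "'a::euclidean_space set"
  assumes "convex S" "open U" "rel_interior S \<inter> U \<noteq> {}"
  shows "open_cell_sign (rel_interior S \<inter> U) = (- 1) ^ nat (aff_dim S)"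
proof -
  have "aff_dim (rel_interior S \<inter> U) = aff_dim (rel_interior S)"
    using assms by (intro aff_dim_convex_Int_open convex_rel_interior) auto
  also have "\<dots> = aff_dim S"
    by (metis assms(1) aff_dim_affine_hull rel_interior_same_affine_hull)
  finally show ?thesis using assms(3) by (simp add: open_cell_sign_def)
qed

text \<open>Inside \<open>U\<close> the indicators of the cells add up to that of the relative
  interior of \<open>P\<close>, and this is the relation used. A small ball as \<open>U\<close>
  gives the local form, a ball around all of \<open>P\<close> the global one.\<close>

lemma euler_relation_open_decomposition:
  fixes P :: "'a::euclidean_space set"
  assumes fin: "finite T" and T: "\<And>\<sigma>. \<sigma> \<in> T \<Longrightarrow> convex \<sigma> \<and> rel_interior \<sigma> \<inter> U \<noteq> {}"
    and disj: "disjoint_family_on rel_interior T"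
    and P: "convex P" "rel_interior P \<inter> U \<noteq> {}"
    and U: "open U" "convex U" "bounded U"
    and un: "(\<Union>\<sigma>\<in>T. rel_interior \<sigma> \<inter> U) = rel_interior P \<inter> U"
  shows "(\<Sum>\<sigma>\<in>T. (- 1) ^ nat (aff_dim \<sigma>)) = (- 1 :: real) ^ nat (aff_dim P)"
proof -
  \<comment> \<open>\<open>None\<close> stands for \<open>P\<close>. A separate index is required
    because \<open>P\<close> may itself be one of the cells.\<close>
  define I where "I = insert None (Some ` T)"
  define S where "S i = (case i of None \<Rightarrow> P | Some \<sigma> \<Rightarrow> \<sigma>)" for i
  define c :: "'a set option \<Rightarrow> real" where "c i = (case i of None \<Rightarrow> - 1 | Some \<sigma> \<Rightarrow> 1)" for i
  have sumI: "(\<Sum>i\<in>I. c i * f (S i)) = (\<Sum>\<sigma>\<in>T. f \<sigma>) - f P" for f :: "'a set \<Rightarrow> real"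
  proof -
    have "(\<Sum>i\<in>I. c i * f (S i)) = c None * f (S None) + (\<Sum>i\<in>Some ` T. c i * f (S i))"
      unfolding I_def using fin by (subst sum.insert) auto
    also have "(\<Sum>i\<in>Some ` T. c i * f (S i)) = (\<Sum>\<sigma>\<in>T. f \<sigma>)"
      by (subst sum.reindex) (auto simp: c_def S_def)
    finally show ?thesis by (simp add: c_def S_def)
  qed
  have "(\<Sum>i\<in>I. c i * open_cell_sign (rel_interior (S i) \<inter> U)) = 0"
  proof (rule euler_relation)
    show "finite I" using fin by (simp add: I_def)
    fix i assume "i \<in> I"
    then have "convex (S i)" using T \<open>convex P\<close> by (auto simp: I_def S_def)
    then show "convex (rel_interior (S i) \<inter> U) \<and> rel_open (rel_interior (S i) \<inter> U)
        \<and> bounded (rel_interior (S i) \<inter> U)"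
      using U by (simp add: convex_Int convex_rel_interior rel_open_Int_open rel_interior_rel_open
        bounded_Int)
  next
    fix y
    have "(\<Sum>\<sigma>\<in>T. indicator (rel_interior \<sigma> \<inter> U) y) = (indicator (rel_interior P \<inter> U) y :: real)"
    proof (cases "y \<in> rel_interior P \<inter> U")
      case True
      then obtain \<sigma> where \<sigma>: "\<sigma> \<in> T" "y \<in> rel_interior \<sigma>" using un by blast
      have "(\<Sum>\<tau>\<in>T. indicator (rel_interior \<tau> \<inter> U) y) = (\<Sum>\<tau>\<in>T. if \<tau> = \<sigma> then 1 else (0::real))"
      proof (rule sum.cong[OF refl])
        fix \<tau> assume "\<tau> \<in> T"
        then have "y \<in> rel_interior \<tau> \<longleftrightarrow> \<tau> = \<sigma>"
          using \<sigma> disjoint_family_onD[OF disj \<open>\<tau> \<in> T\<close> \<sigma>(1)] by blast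
        then show "indicator (rel_interior \<tau> \<inter> U) y = (if \<tau> = \<sigma> then 1 else (0::real))"
          using True by auto
      qed
      then show ?thesis using True fin \<sigma>(1) by simp
    next
      case False
      have "indicator (rel_interior \<sigma> \<inter> U) y = (0::real)" if "\<sigma> \<in> T" for \<sigma>
        using that False un by (auto simp: indicator_def)
      then show ?thesis using False by simp
    qed
    then show "(\<Sum>i\<in>I. c i * indicator (rel_interior (S i) \<inter> U) y) = 0"
      by (subst sumI) simp
  qed
  then have "(\<Sum>\<sigma>\<in>T. open_cell_sign (rel_interior \<sigma> \<inter> U)) = open_cell_sign (rel_interior P \<inter> U)"
    by (subst (asm) sumI) simp
  moreover have "open_cell_sign (rel_interior \<sigma> \<inter> U) = (- 1) ^ nat (aff_dim \<sigma>)" if "\<sigma> \<in> T" for \<sigma>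
    using that T U(1) by (intro open_cell_sign_rel_interior_Int_open) auto
  moreover have "open_cell_sign (rel_interior P \<inter> U) = (- 1) ^ nat (aff_dim P)"
    using P U(1) by (intro open_cell_sign_rel_interior_Int_open)
  ultimately show ?thesis by simp
qed

lemma rel_interior_Int_ball_nonempty:
  fixes S :: "'a::euclidean_space set"
  assumes "convex S" "x \<in> S" "e > 0"
  shows "rel_interior S \<inter> ball x e \<noteq> {}"
proof -
  have "x \<in> closure (rel_interior S)"
    using assms convex_closure_rel_interior closure_subset by blast
  then obtain y where "y \<in> rel_interior S" "dist y x < e"
    using assms(3) unfolding closure_approachable by blast
  then show ?thesis by (auto simp: dist_commute)
qed

text \<open>Inside a small ball around \<open>x\<close> exactly the cells whose closure contains \<open>x\<close> are visible.\<close>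

lemma local_euler_relation:
  fixes P :: "'a::euclidean_space set"
  assumes "finite T" and T: "\<And>\<sigma>. \<sigma> \<in> T \<Longrightarrow> convex \<sigma> \<and> closed \<sigma>"
    and disj: "disjoint_family_on rel_interior T"
    and un: "(\<Union>\<sigma>\<in>T. rel_interior \<sigma>) = rel_interior P"
    and "convex P" "x \<in> P"
  shows "(\<Sum>\<sigma> | \<sigma> \<in> T \<and> x \<in> \<sigma>. (- 1) ^ nat (aff_dim \<sigma>)) = (- 1 :: real) ^ nat (aff_dim P)"
proof -
  have "closed (\<Union>{\<sigma> \<in> T. x \<notin> \<sigma>})"
    using assms(1) T by (intro closed_Union) auto
  then obtain e where e: "e > 0" "ball x e \<subseteq> - \<Union>{\<sigma> \<in> T. x \<notin> \<sigma>}"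
    using openE[of "- \<Union>{\<sigma> \<in> T. x \<notin> \<sigma>}" x] by (auto simp: open_Compl)
  show ?thesis
  proof (rule euler_relation_open_decomposition[where U = "ball x e"])
    show "disjoint_family_on rel_interior {\<sigma> \<in> T. x \<in> \<sigma>}"
      using disj by (rule disjoint_family_on_mono[rotated]) auto
    show "(\<Union>\<sigma>\<in>{\<sigma> \<in> T. x \<in> \<sigma>}. rel_interior \<sigma> \<inter> ball x e) = rel_interior P \<inter> ball x e"
    proof (intro equalityI subsetI)
      fix y assume y: "y \<in> rel_interior P \<inter> ball x e"
      then obtain \<sigma> where \<sigma>: "\<sigma> \<in> T" "y \<in> rel_interior \<sigma>" using un by blast
      then have "y \<in> \<sigma>" using rel_interior_subset by blast
      moreover have "y \<notin> \<Union>{\<sigma> \<in> T. x \<notin> \<sigma>}" using y e(2) by blast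
      ultimately have "x \<in> \<sigma>" using \<sigma>(1) by blast
      then show "y \<in> (\<Union>\<sigma>\<in>{\<sigma> \<in> T. x \<in> \<sigma>}. rel_interior \<sigma> \<inter> ball x e)" using \<sigma> y by blast
    qed (use un in blast)
  qed (use assms(1,5,6) T e(1) in \<open>simp_all add: rel_interior_Int_ball_nonempty\<close>)
qed

text \<open>Serves the argument 0, where every closed cell contributes its sign whatever its
  position.\<close>

lemma global_euler_relation:
  fixes P :: "'a::euclidean_space set"
  assumes "finite T" and T: "\<And>\<sigma>. \<sigma> \<in> T \<Longrightarrow> convex \<sigma> \<and> \<sigma> \<noteq> {}"
    and disj: "disjoint_family_on rel_interior T"
    and un: "(\<Union>\<sigma>\<in>T. rel_interior \<sigma>) = rel_interior P"
    and P: "convex P" "bounded P" "P \<noteq> {}"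
  shows "(\<Sum>\<sigma>\<in>T. (- 1) ^ nat (aff_dim \<sigma>)) = (- 1 :: real) ^ nat (aff_dim P)"
proof -
  obtain e where "P \<subseteq> ball 0 e" using P(2) bounded_subset_ballD by blast
  then have sub: "rel_interior P \<subseteq> ball 0 e" using rel_interior_subset by blast
  then have subT: "rel_interior \<sigma> \<subseteq> ball 0 e" if "\<sigma> \<in> T" for \<sigma> using un that by blast
  show ?thesis
  proof (rule euler_relation_open_decomposition[where U = "ball 0 e"])
    show "convex \<sigma> \<and> rel_interior \<sigma> \<inter> ball 0 e \<noteq> {}" if "\<sigma> \<in> T" for \<sigma>
      using T[OF that] subT[OF that] rel_interior_eq_empty[of \<sigma>] by auto
    show "rel_interior P \<inter> ball 0 e \<noteq> {}" using sub P rel_interior_eq_empty[of P] by auto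
    show "(\<Union>\<sigma>\<in>T. rel_interior \<sigma> \<inter> ball 0 e) = rel_interior P \<inter> ball 0 e" using un by blast
  qed (use assms in auto)
qed

section \<open>Denominators\<close>

lemma extreme_points_scaleR:
  fixes P :: "(real^'n) set"
  assumes "d \<noteq> 0"
  shows "a extreme_point_of ((\<lambda>x. d *\<^sub>R x) ` P) \<longleftrightarrow> (\<exists>b. b extreme_point_of P \<and> a = d *\<^sub>R b)"
proof -
  have lin: "linear (\<lambda>x::real^'n. d *\<^sub>R x)" "inj (\<lambda>x::real^'n. d *\<^sub>R x)"
    using assms by (auto simp: linear_iff scaleR_add_right inj_def)
  have iff: "(\<lambda>x. d *\<^sub>R x) ` S face_of (\<lambda>x. d *\<^sub>R x) ` P \<longleftrightarrow> S face_of P" for S :: "(real^'n) set"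
    using face_of_linear_image[OF lin] .
  show ?thesis
  proof
    assume a: "a extreme_point_of ((\<lambda>x. d *\<^sub>R x) ` P)"
    then obtain b where b: "a = d *\<^sub>R b" by (auto simp: extreme_point_of_def)
    then show "\<exists>b. b extreme_point_of P \<and> a = d *\<^sub>R b"
      using a iff[of "{b}"] by (auto simp: face_of_singleton)
  next
    assume "\<exists>b. b extreme_point_of P \<and> a = d *\<^sub>R b"
    then obtain b where "b extreme_point_of P" "a = d *\<^sub>R b" by blast
    then show "a extreme_point_of ((\<lambda>x. d *\<^sub>R x) ` P)"
      using iff[of "{b}"] by (auto simp: face_of_singleton)
  qed
qed

lemma integral_polytope_scaleR_iff:
  fixes P :: "(real^'n) set"
  assumes "polytope P" "P \<noteq> {}" "d \<noteq> 0"
  shows "integral_polytope ((\<lambda>x. d *\<^sub>R x) ` P) \<longleftrightarrow>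
    (\<forall>a. a extreme_point_of P \<longrightarrow> d *\<^sub>R a \<in> int_lattice)"
  using assms polytope_scaling[of P d]
  by (auto simp: integral_polytope_def extreme_points_scaleR)

lemma int_lattice_add: "x \<in> int_lattice \<Longrightarrow> y \<in> int_lattice \<Longrightarrow> x + y \<in> int_lattice"
  by (simp add: int_lattice_def)

lemma int_lattice_diff: "x \<in> int_lattice \<Longrightarrow> y \<in> int_lattice \<Longrightarrow> x - y \<in> int_lattice"
  by (simp add: int_lattice_def)

lemma int_lattice_minus_iff: "- x \<in> int_lattice \<longleftrightarrow> x \<in> int_lattice"
  by (simp add: int_lattice_def)

lemma int_lattice_scaleR: "x \<in> int_lattice \<Longrightarrow> c \<in> \<int> \<Longrightarrow> c *\<^sub>R x \<in> int_lattice"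
  by (simp add: int_lattice_def)

lemma int_lattice_sum: "(\<And>i. i \<in> I \<Longrightarrow> f i \<in> int_lattice) \<Longrightarrow> sum f I \<in> int_lattice"
  by (auto simp: int_lattice_def intro!: Ints_sum)

lemma zero_in_int_lattice: "0 \<in> int_lattice"
  by (simp add: int_lattice_def)

lemma common_denominator_Rats:
  fixes Q :: "real set"
  assumes "finite Q" "Q \<subseteq> \<rat>"
  shows "\<exists>m::nat. m > 0 \<and> (\<forall>q\<in>Q. real m * q \<in> \<int>)"
  using assms
proof (induction Q rule: finite_induct)
  case (insert q Q)
  then obtain m :: nat where m: "m > 0" "\<forall>q\<in>Q. real m * q \<in> \<int>" by auto
  from insert.prems obtain a b where ab: "b > 0" "q = of_int a / of_int b"
    by (auto elim!: Rats_cases')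
  have "real (nat b * m) * q \<in> \<int>"
  proof -
    have "real (nat b * m) * q = of_int (int m * a)" using ab by simp
    then show ?thesis by (metis Ints_of_int)
  qed
  moreover have "real (nat b * m) * q' \<in> \<int>" if "q' \<in> Q" for q'
  proof -
    have "real (nat b * m) * q' = of_int b * (real m * q')" using ab by simp
    then show ?thesis using m that by (metis Ints_mult Ints_of_int)
  qed
  ultimately show ?case using m ab by (intro exI[of _ "nat b * m"]) auto
qed (auto intro: exI[of _ 1])

lemma common_denominator:
  fixes V :: "(real^'n) set"
  assumes "finite V" "\<And>a i. a \<in> V \<Longrightarrow> a $ i \<in> \<rat>"
  obtains m :: nat where "m > 0" "\<And>a. a \<in> V \<Longrightarrow> real m *\<^sub>R a \<in> int_lattice"
proof -
  have "finite ((\<lambda>(a, i). a $ i) ` (V \<times> UNIV))" using assms(1) by auto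
  moreover have "(\<lambda>(a, i). a $ i) ` (V \<times> UNIV) \<subseteq> \<rat>" using assms(2) by auto
  ultimately obtain m :: nat where "m > 0" "\<forall>q\<in>(\<lambda>(a, i). a $ i) ` (V \<times> UNIV). real m * q \<in> \<int>"
    using common_denominator_Rats by blast
  then show thesis by (intro that[of m]) (auto simp: int_lattice_def)
qed

lemma polytope_finite_extreme_points:
  fixes P :: "'a::euclidean_space set"
  shows "polytope P \<Longrightarrow> finite {a. a extreme_point_of P}"
  using finite_polyhedron_extreme_points polytope_imp_polyhedron by blast

lemma convex_hull_extreme_points_polytope:
  fixes P :: "'a::euclidean_space set"
  shows "polytope P \<Longrightarrow> convex hull {a. a extreme_point_of P} = P"
  by (rule Krein_Milman_Minkowski[symmetric]) (simp_all add: polytope_imp_compact polytope_imp_convex)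

lemma ex_nonzero_extreme_point:
  fixes P :: "(real^'n) set"
  assumes "polytope P" "P \<noteq> {}" "P \<noteq> {0}"
  obtains a i where "a extreme_point_of P" "a $ i \<noteq> 0"
proof -
  have "\<exists>a. a extreme_point_of P \<and> a \<noteq> 0"
  proof (rule ccontr)
    assume "\<not> ?thesis"
    then have "convex hull {a. a extreme_point_of P} \<subseteq> convex hull {0}"
      by (intro hull_mono) auto
    then have "P \<subseteq> {0}" using convex_hull_extreme_points_polytope[OF assms(1)] by simp
    then show False using assms(2,3) by auto
  qed
  then show thesis using that by (metis vec_eq_iff zero_index)
qed

text \<open>A least element among reals has to be attained. A nonzero coordinate of some vertex
  turns each admissible factor into a positive integer, so only finitely many of them lie below a
  common denominator of the vertices.\<close>

lemma polytope_denominator_exists: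
  fixes P :: "(real^'n) set"
  assumes P: "rational_polytope P" and ne: "P \<noteq> {0}"
  shows "\<exists>d>0. (\<forall>a. a extreme_point_of P \<longrightarrow> d *\<^sub>R a \<in> int_lattice) \<and>
    (\<forall>e>0. (\<forall>a. a extreme_point_of P \<longrightarrow> e *\<^sub>R a \<in> int_lattice) \<longrightarrow> d \<le> e)"
proof -
  define S where "S = {d. 0 < d \<and> (\<forall>a. a extreme_point_of P \<longrightarrow> d *\<^sub>R a \<in> int_lattice)}"
  have poly: "polytope P" "P \<noteq> {}" using P by (auto simp: rational_polytope_def)
  obtain m :: nat where m: "m > 0" "\<And>a. a \<in> {a. a extreme_point_of P} \<Longrightarrow> real m *\<^sub>R a \<in> int_lattice"
    using common_denominator[OF polytope_finite_extreme_points[OF poly(1)]] P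
    by (auto simp: rational_polytope_def)
  then have mS: "real m \<in> S" by (simp add: S_def)
  obtain a i where a: "a extreme_point_of P" "a $ i \<noteq> 0"
    using ex_nonzero_extreme_point[OF poly ne] .
  have fin: "finite (S \<inter> {..real m})"
  proof (rule finite_imageD)
    have "(\<lambda>d. d * \<bar>a $ i\<bar>) ` (S \<inter> {..real m}) \<subseteq> of_int ` {0..\<lfloor>real m * \<bar>a $ i\<bar>\<rfloor>}"
    proof (rule image_subsetI)
      fix d assume d: "d \<in> S \<inter> {..real m}"
      then have "d * a $ i \<in> \<int>" using a by (auto simp: S_def int_lattice_def)
      then have "d * \<bar>a $ i\<bar> \<in> \<int>" by (cases "a $ i \<ge> 0") (auto simp: abs_if)
      then obtain z where z: "d * \<bar>a $ i\<bar> = of_int z" by (auto elim: Ints_cases)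
      have "0 \<le> d * \<bar>a $ i\<bar>" "d * \<bar>a $ i\<bar> \<le> real m * \<bar>a $ i\<bar>"
        using d by (auto simp: S_def intro!: mult_right_mono)
      then have "z \<in> {0..\<lfloor>real m * \<bar>a $ i\<bar>\<rfloor>}" by (auto simp: z le_floor_iff)
      then show "d * \<bar>a $ i\<bar> \<in> of_int ` {0..\<lfloor>real m * \<bar>a $ i\<bar>\<rfloor>}" using z by blast
    qed
    then show "finite ((\<lambda>d. d * \<bar>a $ i\<bar>) ` (S \<inter> {..real m}))"
      by (rule finite_subset) simp
    show "inj_on (\<lambda>d. d * \<bar>a $ i\<bar>) (S \<inter> {..real m})" using a by (auto simp: inj_on_def)
  qed
  define d where "d = Min (S \<inter> {..real m})"
  have "d \<in> S \<inter> {..real m}" unfolding d_def using fin mS by (intro Min_in) auto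
  moreover have "d \<le> e" if "e \<in> S" for e
  proof (cases "e \<le> real m")
    case True
    then show ?thesis unfolding d_def using fin that by (intro Min_le) auto
  next
    case False
    then show ?thesis using calculation by auto
  qed
  ultimately show ?thesis by (intro exI[of _ d]) (auto simp: S_def)
qed

text \<open>The admissible factors are closed under integral combinations, so the remainder of
  \<open>e\<close> modulo the denominator is admissible as well and, by minimality, zero. For
  \<open>{0}\<close> every real is admissible, which is why divisibility excludes it.\<close>

lemma
  fixes P :: "(real^'n) set"
  assumes P: "rational_polytope P"
  shows polytope_denominator_pos: "polytope_denominator P > 0"
    and polytope_denominator_integral:
      "a extreme_point_of P \<Longrightarrow> polytope_denominator P *\<^sub>R a \<in> int_lattice"
    and polytope_denominator_dvd:
      "P \<noteq> {0} \<Longrightarrow> (\<And>a. a extreme_point_of P \<Longrightarrow> e *\<^sub>R a \<in> int_lattice) \<Longrightarrow>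
        \<exists>z::int. e = of_int z * polytope_denominator P"
proof -
  define d where "d = polytope_denominator P"
  have *: "d > 0 \<and> (\<forall>a. a extreme_point_of P \<longrightarrow> d *\<^sub>R a \<in> int_lattice) \<and>
    (P \<noteq> {0} \<longrightarrow> (\<forall>e>0. (\<forall>a. a extreme_point_of P \<longrightarrow> e *\<^sub>R a \<in> int_lattice) \<longrightarrow> d \<le> e))"
  proof (cases "P = {0}")
    case True
    then show ?thesis
      by (auto simp: d_def polytope_denominator_def extreme_point_of_def zero_in_int_lattice)
  next
    case False
    have poly: "polytope P" "P \<noteq> {}" using P by (auto simp: rational_polytope_def)
    obtain d0 where d0: "d0 > 0" "\<forall>a. a extreme_point_of P \<longrightarrow> d0 *\<^sub>R a \<in> int_lattice"
      "\<forall>e>0. (\<forall>a. a extreme_point_of P \<longrightarrow> e *\<^sub>R a \<in> int_lattice) \<longrightarrow> d0 \<le> e"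
      using polytope_denominator_exists[OF P False] by auto
    have "(LEAST d. 0 < d \<and> integral_polytope ((\<lambda>x. d *\<^sub>R x) ` P)) = d0"
      by (rule Least_equality) (use d0 integral_polytope_scaleR_iff[OF poly] in auto)
    then show ?thesis using d0 False by (simp add: d_def polytope_denominator_def)
  qed
  then show "polytope_denominator P > 0"
    and "a extreme_point_of P \<Longrightarrow> polytope_denominator P *\<^sub>R a \<in> int_lattice"
    by (auto simp: d_def)
  assume ne: "P \<noteq> {0}" and e: "\<And>a. a extreme_point_of P \<Longrightarrow> e *\<^sub>R a \<in> int_lattice"
  define z where "z = \<lfloor>e / d\<rfloor>"
  define f where "f = e - of_int z * d"
  have d: "d > 0" using * by simp
  have f: "0 \<le> f" "f < d"
  proof -
    have "of_int z \<le> e / d" "e / d < of_int z + 1" unfolding z_def by linarith+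
    then show "0 \<le> f" "f < d" using d by (simp_all add: f_def pos_le_divide_eq pos_divide_less_eq algebra_simps)
  qed
  have "f *\<^sub>R a \<in> int_lattice" if "a extreme_point_of P" for a
  proof -
    have "f *\<^sub>R a = e *\<^sub>R a - of_int z *\<^sub>R (d *\<^sub>R a)" by (simp add: f_def algebra_simps)
    moreover have "of_int z *\<^sub>R (d *\<^sub>R a) \<in> int_lattice"
      by (rule int_lattice_scaleR) (use * that in auto)
    ultimately show ?thesis using int_lattice_diff[OF e[OF that]] by simp
  qed
  then have "\<not> f > 0" using * f(2) ne by (meson not_less)
  then have "f = 0" using f(1) by simp
  then show "\<exists>z::int. e = of_int z * polytope_denominator P"
    by (intro exI[of _ z]) (simp add: f_def d_def)
qed

lemma neg_frac_add_of_int: "neg_frac (x + of_int z) = neg_frac x"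
  by (simp add: neg_frac_def)

lemma neg_frac_bounds: "- 1 < neg_frac x" "neg_frac x \<le> 0"
  unfolding neg_frac_def by linarith+

text \<open>Supplies periodicity where divisibility fails: a constant has every period. Only
  \<open>j = 1\<close> occurs, with total weight in (0, 1], and the truncated subtraction
  \<open>0 - k\<close> gives the value 1 for every \<open>k\<close>.\<close>

lemma simplex_coeff_singleton_zero: "simplex_coeff ({0} :: (real^'n) set) k t = 1"
proof -
  have ext: "{a. a extreme_point_of {0 :: real^'n}} = {0}"
    by (auto simp: extreme_point_of_def)
  have "D_bar {0 :: real^'n} l = {0}" if "0 < l" "l \<le> 1" for l
  proof -
    have "\<exists>v :: real^'n \<Rightarrow> real. 0 < v 0 \<and> v 0 \<le> 1 \<and> v 0 = l" using that by (intro exI[of _ "\<lambda>_. l"]) simp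
    moreover have "a extreme_point_of {0} \<longleftrightarrow> a = 0" for a :: "real^'n" using ext by blast
    ultimately show ?thesis
      by (auto simp: D_bar_def polytope_denominator_def zero_in_int_lattice)
  qed
  moreover have "{S. S \<subseteq> {} \<and> card S = (0::nat)} = {{} :: nat set}" by auto
  ultimately show ?thesis using neg_frac_bounds[of t]
    by (simp add: simplex_coeff_def polytope_denominator_def Let_def elem_sym_def)
qed

text \<open>The argument enters only through \<open>neg_frac (t / d)\<close>, and a factor that
  clears all vertices is an integral multiple of the denominator.\<close>

lemma simplex_coeff_periodic:
  fixes \<sigma> :: "(real^'n) set"
  assumes "rational_polytope \<sigma>" "\<And>a. a extreme_point_of \<sigma> \<Longrightarrow> e *\<^sub>R a \<in> int_lattice"
  shows "simplex_coeff \<sigma> k (t + e) = simplex_coeff \<sigma> k t"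
proof (cases "\<sigma> = {0}")
  case True
  then show ?thesis by (simp add: simplex_coeff_singleton_zero)
next
  case False
  let ?d = "polytope_denominator \<sigma>"
  obtain z :: int where z: "e = of_int z * ?d"
    using polytope_denominator_dvd[OF assms(1) False assms(2)] by blast
  have "(t + e) / ?d = t / ?d + of_int z"
    using polytope_denominator_pos[OF assms(1)] by (simp add: z add_divide_distrib)
  then have "neg_frac ((t + e) / ?d) = neg_frac (t / ?d)" by (simp add: neg_frac_add_of_int)
  then show ?thesis by (simp add: simplex_coeff_def)
qed

section \<open>Lattice points of dilated simplices\<close>

text \<open>Used with \<open>y = t / d\<close>: it folds the cell coefficients, weighted by the
  powers of t, into products that can be compared with binomial coefficients.\<close>

lemma elem_sym_generating_function:
  "(\<Sum>k = 0..n. elem_sym n (n - k) x * y ^ k) = (\<Prod>i = 1..n. x i + y)"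
proof -
  have "(\<Prod>i = 1..n. x i + y) = (\<Sum>X\<in>Pow {1..n}. (\<Prod>i\<in>X. x i) * y ^ (n - card X))"
  proof -
    have "card ({1..n} - X) = n - card X" if "X \<subseteq> {1..n}" for X
      using that by (subst card_Diff_subset) (auto intro: finite_subset)
    then show ?thesis by (subst prod_add) auto
  qed
  also have "\<dots> = (\<Sum>k = 0..n. \<Sum>X | X \<in> Pow {1..n} \<and> n - card X = k. (\<Prod>i\<in>X. x i) * y ^ (n - card X))"
    by (rule sum.group[symmetric]) auto
  also have "\<dots> = (\<Sum>k = 0..n. elem_sym n (n - k) x * y ^ k)"
  proof (rule sum.cong[OF refl])
    fix k assume "k \<in> {0..n}"
    moreover have "card X \<le> n" if "X \<subseteq> {1..n}" for X
      using card_mono[OF _ that] by simp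
    ultimately have "{X. X \<in> Pow {1..n} \<and> n - card X = k} = {S. S \<subseteq> {1..n} \<and> card S = n - k}"
      by auto
    moreover have "(\<Sum>X | X \<in> Pow {1..n} \<and> n - card X = k. (\<Prod>i\<in>X. x i) * y ^ (n - card X))
        = (\<Sum>X | X \<in> Pow {1..n} \<and> n - card X = k. (\<Prod>i\<in>X. x i) * y ^ k)"
      by (rule sum.cong) auto
    ultimately show "(\<Sum>X | X \<in> Pow {1..n} \<and> n - card X = k. (\<Prod>i\<in>X. x i) * y ^ (n - card X))
        = elem_sym n (n - k) x * y ^ k"
      by (simp add: elem_sym_def sum_distrib_right)
  qed
  finally show ?thesis by simp
qed

section \<open>Compositions with a prescribed sum\<close>

lemma fact_mult_binomial_eq_prod: "fact n * real ((k + n) choose n) = (\<Prod>i = 1..n. real k + real i)"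
proof -
  have "(fact (k + n) :: real) = fact k * (\<Prod>i = 1..n. real k + real i)"
    by (induction n) (auto simp: algebra_simps)
  moreover have "fact n * fact k * real ((k + n) choose n) = fact (k + n)"
    using binomial_fact[of n "k + n", where ?'a = real] by simp
  ultimately have "fact k * (fact n * real ((k + n) choose n)) = fact k * (\<Prod>i = 1..n. real k + real i)"
    by (simp add: mult_ac)
  then show ?thesis by simp
qed

text \<open>The sum is an integer because the totals met below can be negative, with no composition
  at all. Extensional functions keep one representative for each assignment on
  \<open>V\<close>.\<close>

definition compositions :: "'a set \<Rightarrow> int \<Rightarrow> ('a \<Rightarrow> nat) set" where
  "compositions V k = {u \<in> V \<rightarrow>\<^sub>E UNIV. int (\<Sum>a\<in>V. u a) = k}"

lemma finite_compositions: "finite V \<Longrightarrow> finite (compositions V k)"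
proof (rule finite_subset)
  assume V: "finite V"
  show "compositions V k \<subseteq> V \<rightarrow>\<^sub>E {..nat k}"
  proof
    fix u assume u: "u \<in> compositions V k"
    have "u a \<le> nat k" if "a \<in> V" for a
      using member_le_sum[of a V u] V that u by (auto simp: compositions_def simp del: of_nat_sum)
    then show "u \<in> V \<rightarrow>\<^sub>E {..nat k}" using u by (auto simp: compositions_def PiE_iff)
  qed
  show "finite (V \<rightarrow>\<^sub>E {..nat k})" using V by (intro finite_PiE) auto
qed

text \<open>Stars and bars: an enumeration of \<open>V\<close> turns compositions into lists of
  prescribed length and sum.\<close>

lemma card_compositions_nat:
  assumes "finite V" "card V = Suc n"
  shows "card (compositions V (int k)) = (k + n) choose n"
proof -
  obtain xs where xs: "set xs = V" "distinct xs" using assms(1) finite_distinct_list by blast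
  then have len: "length xs = Suc n" using assms(2) distinct_card[of xs] by simp
  have sums: "sum_list (map u xs) = sum u V" for u :: "'a \<Rightarrow> nat"
    using xs by (simp add: sum_list_distinct_conv_sum_set)
  have "bij_betw (\<lambda>u. map u xs) (compositions V (int k)) {l. size l = Suc n \<and> sum_list l = k}"
  proof (rule bij_betwI[where g = "\<lambda>l. restrict (\<lambda>a. the (map_of (zip xs l) a)) V"])
    show "(\<lambda>u. map u xs) \<in> compositions V (int k) \<rightarrow> {l. size l = Suc n \<and> sum_list l = k}"
      by (auto simp: compositions_def sums len simp del: of_nat_sum)
  next
    have *: "map (restrict (\<lambda>a. the (map_of (zip xs l) a)) V) xs = l" if "length l = Suc n" for l :: "nat list"
      by (rule nth_equalityI) (use that len xs in \<open>auto simp: map_of_zip_nth\<close>)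
    then show "\<And>l. l \<in> {l. size l = Suc n \<and> sum_list l = k} \<Longrightarrow>
      map (restrict (\<lambda>a. the (map_of (zip xs l) a)) V) xs = l" by simp
    show "(\<lambda>l. restrict (\<lambda>a. the (map_of (zip xs l) a)) V) \<in> {l. size l = Suc n \<and> sum_list l = k} \<rightarrow> compositions V (int k)"
    proof
      fix l :: "nat list" assume l: "l \<in> {l. size l = Suc n \<and> sum_list l = k}"
      have "sum (restrict (\<lambda>a. the (map_of (zip xs l) a)) V) V = k"
        using *[of l] sums[of "restrict (\<lambda>a. the (map_of (zip xs l) a)) V"] l by simp
      then show "restrict (\<lambda>a. the (map_of (zip xs l) a)) V \<in> compositions V (int k)"
        by (simp add: compositions_def del: of_nat_sum)
    qed
  next
    fix u assume u: "u \<in> compositions V (int k)"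
    show "restrict (\<lambda>a. the (map_of (zip xs (map u xs)) a)) V = u"
    proof
      fix a
      show "restrict (\<lambda>a. the (map_of (zip xs (map u xs)) a)) V a = u a"
      proof (cases "a \<in> V")
        case True
        then show ?thesis using xs by (simp add: map_of_zip_map)
      next
        case False
        moreover have "u \<in> V \<rightarrow>\<^sub>E UNIV" using u by (simp add: compositions_def)
        ultimately show ?thesis using PiE_arb[of u V "\<lambda>_. UNIV" a] by simp
      qed
    qed
  qed
  from bij_betw_same_card[OF this] have "card (compositions V (int k)) = (k + Suc n - 1) choose k"
    unfolding card_length_sum_list .
  also have "\<dots> = (k + n) choose n" by (subst binomial_symmetric) simp_all
  finally show ?thesis .
qed

text \<open>For \<open>-n \<le> k < 0\<close> both sides vanish.\<close>

lemma card_compositions: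
  assumes "finite V" "card V = Suc n" "k \<ge> - int n"
  shows "fact n * real (card (compositions V k)) = (\<Prod>i = 1..n. of_int k + real i)"
proof (cases "k \<ge> 0")
  case True
  then show ?thesis
    using card_compositions_nat[OF assms(1,2), of "nat k"] fact_mult_binomial_eq_prod[of n "nat k"] by simp
next
  case False
  then have "compositions V k = {}"
    by (auto simp: compositions_def simp del: of_nat_sum)
  moreover have "(\<Prod>i = 1..n. real_of_int k + real i) = 0"
  proof (rule prod_zero)
    show "\<exists>i\<in>{1..n}. real_of_int k + real i = 0"
      using False assms(3) by (intro bexI[of _ "nat (- k)"]) auto
  qed simp
  ultimately show ?thesis by simp
qed

section \<open>Lattice points and their vertex weights\<close>

lemma finite_bounded_Int_int_lattice:
  fixes S :: "(real^'n) set"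
  assumes "bounded S"
  shows "finite (S \<inter> int_lattice)"
proof -
  obtain B where B: "\<And>x. x \<in> S \<Longrightarrow> norm x \<le> B" using assms bounded_iff by blast
  let ?F = "real_of_int ` {- \<lceil>B\<rceil>..\<lceil>B\<rceil>}"
  have "vec_nth ` (S \<inter> int_lattice) \<subseteq> UNIV \<rightarrow>\<^sub>E ?F"
  proof (rule image_subsetI)
    fix x assume x: "x \<in> S \<inter> int_lattice"
    have "x $ i \<in> ?F" for i
    proof -
      obtain z where z: "x $ i = of_int z" using x by (auto simp: int_lattice_def elim: Ints_cases)
      have "\<bar>x $ i\<bar> \<le> B" using B[of x] x component_le_norm_cart[of x i] by auto
      then have "z \<in> {- \<lceil>B\<rceil>..\<lceil>B\<rceil>}" using z by (auto simp: abs_le_iff) linarith+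
      then show ?thesis using z by blast
    qed
    then show "vec_nth x \<in> UNIV \<rightarrow>\<^sub>E ?F" by (simp add: PiE_iff)
  qed
  moreover have "finite ((UNIV :: 'n set) \<rightarrow>\<^sub>E ?F)" by (intro finite_PiE) auto
  ultimately have "finite (vec_nth ` (S \<inter> int_lattice))" by (rule finite_subset)
  then show ?thesis by (rule finite_imageD) (auto simp: inj_on_def vec_nth_inject)
qed

text \<open>Three ranges \<open>Y\<close> occur: \<open>{0<..d}\<close> for the sets in the
  coefficient formula, \<open>{0<..}\<close> for points of a dilated open simplex and
  \<open>{0..}\<close> for points of a dilated closed one.\<close>

definition lattice_weights :: "(real^'n) set \<Rightarrow> real set \<Rightarrow> real \<Rightarrow> (real^'n \<Rightarrow> real) set" where
  "lattice_weights V Y l =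
     {v \<in> V \<rightarrow>\<^sub>E Y. (\<Sum>a\<in>V. v a) = l \<and> (\<Sum>a\<in>V. v a *\<^sub>R a) \<in> int_lattice}"

text \<open>The difference of two such weights would be an affine dependence. Hence counting lattice
  points is counting weights.\<close>

lemma inj_on_weighted_sum:
  fixes V :: "'a::euclidean_space set"
  assumes "\<not> affine_dependent V"
  shows "inj_on (\<lambda>v. \<Sum>a\<in>V. v a *\<^sub>R a) {v \<in> extensional V. (\<Sum>a\<in>V. v a) = (l::real)}"
proof (rule inj_onI)
  fix v w assume v: "v \<in> {v \<in> extensional V. (\<Sum>a\<in>V. v a) = l}"
    and w: "w \<in> {v \<in> extensional V. (\<Sum>a\<in>V. v a) = l}"
    and eq: "(\<Sum>a\<in>V. v a *\<^sub>R a) = (\<Sum>a\<in>V. w a *\<^sub>R a)"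
  have fin: "finite V" using assms aff_independent_finite by blast
  have "(\<Sum>a\<in>V. v a - w a) = 0" "(\<Sum>a\<in>V. (v a - w a) *\<^sub>R a) = 0"
    using v w eq by (simp_all add: sum_subtractf scaleR_left_diff_distrib)
  then have "\<not> (\<exists>a\<in>V. v a - w a \<noteq> 0)"
    using assms unfolding affine_dependent_explicit_finite[OF fin]
    by (intro notI) (erule notE, rule exI[of _ "\<lambda>a. v a - w a"], simp)
  then show "v = w" using v w by (intro extensionalityI[of _ V]) auto
qed

lemma card_lattice_weights_image:
  assumes "\<not> affine_dependent V"
  shows "card ((\<lambda>v. \<Sum>a\<in>V. v a *\<^sub>R a) ` {v \<in> V \<rightarrow>\<^sub>E Y. (\<Sum>a\<in>V. v a) = l} \<inter> int_lattice)
    = card (lattice_weights V Y l)"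
proof -
  have "(\<lambda>v. \<Sum>a\<in>V. v a *\<^sub>R a) ` {v \<in> V \<rightarrow>\<^sub>E Y. (\<Sum>a\<in>V. v a) = l} \<inter> int_lattice
    = (\<lambda>v. \<Sum>a\<in>V. v a *\<^sub>R a) ` lattice_weights V Y l"
    by (auto simp: lattice_weights_def)
  moreover have "inj_on (\<lambda>v. \<Sum>a\<in>V. v a *\<^sub>R a) (lattice_weights V Y l)"
    by (rule inj_on_subset[OF inj_on_weighted_sum[OF assms, of l]])
      (auto simp: lattice_weights_def PiE_def)
  ultimately show ?thesis by (simp add: card_image)
qed

lemma finite_lattice_weights:
  assumes "\<not> affine_dependent V" "bounded Y"
  shows "finite (lattice_weights V Y l)"
proof -
  have fin: "finite V" using assms aff_independent_finite by blast
  obtain B where B: "\<And>y. y \<in> Y \<Longrightarrow> \<bar>y\<bar> \<le> B" using assms(2) by (auto simp: bounded_iff)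
  let ?S = "(\<lambda>v. \<Sum>a\<in>V. v a *\<^sub>R a) ` lattice_weights V Y l"
  have "bounded ?S"
  proof (rule boundedI)
    fix x assume "x \<in> ?S"
    then obtain v where v: "v \<in> V \<rightarrow>\<^sub>E Y" "x = (\<Sum>a\<in>V. v a *\<^sub>R a)" by (auto simp: lattice_weights_def)
    have "norm x \<le> (\<Sum>a\<in>V. norm (v a *\<^sub>R a))" unfolding v(2) by (rule norm_sum)
    also have "\<dots> \<le> (\<Sum>a\<in>V. B * norm a)"
      using v(1) B by (intro sum_mono) (auto intro!: mult_right_mono)
    finally show "norm x \<le> (\<Sum>a\<in>V. B * norm a)" .
  qed
  then have "finite (?S \<inter> int_lattice)" by (rule finite_bounded_Int_int_lattice)
  moreover have "?S \<inter> int_lattice = ?S" by (auto simp: lattice_weights_def)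
  ultimately have "finite ?S" by simp
  then show ?thesis
    by (rule finite_imageD) (rule inj_on_subset[OF inj_on_weighted_sum[OF assms(1), of l]],
      auto simp: lattice_weights_def PiE_def)
qed

text \<open>Each weight is written as \<open>d * u a + (s * w a + c)\<close> with a natural quotient
  and a remainder in (0, d]. Since \<open>d *\<^sub>R a\<close> is integral, \<open>c\<close> is a
  multiple of \<open>d\<close> and \<open>s\<close> is a sign, integrality depends on the remainders
  alone, while the total couples the level of the remainders with the sum of the quotients. The
  instances are \<open>s = 1\<close>, \<open>c = 0\<close> for positive weights and
  \<open>s = - 1\<close>, \<open>c = d\<close> for nonnegative ones.\<close>

lemma card_lattice_weights_split:
  fixes V :: "(real^'n) set" and s c d t :: real
  assumes V: "\<not> affine_dependent V" and d: "\<And>a. a \<in> V \<Longrightarrow> d *\<^sub>R a \<in> int_lattice"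
    and s: "s = 1 \<or> s = - 1" and c: "c = d * c'" "c' \<in> \<int>"
    and bij: "bij_betw (\<lambda>(k::nat, w). d * real k + (s * w + c)) (UNIV \<times> {0<..d}) Y"
    and "finite J" "inj_on l J"
    and level: "\<And>u w. w \<in> V \<rightarrow>\<^sub>E {0<..d} \<Longrightarrow>
      d * real (\<Sum>a\<in>V. u a) + (s * (\<Sum>a\<in>V. w a) + c * real (card V)) = t \<longleftrightarrow>
      (\<exists>j\<in>J. (\<Sum>a\<in>V. w a) = l j \<and> int (\<Sum>a\<in>V. u a) = K j)"
  shows "card (lattice_weights V Y t)
    = (\<Sum>j\<in>J. card (compositions V (K j)) * card (lattice_weights V {0<..d} (l j)))"
proof -
  let ?h = "\<lambda>(k::nat, w). d * real k + (s * w + c)"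
  have fin: "finite V" using V aff_independent_finite by blast
  define Z where "Z j = compositions V (K j) \<times> lattice_weights V {0<..d} (l j)" for j
  \<comment> \<open>\<open>F\<close> recombines quotients and remainders vertex by vertex, and
    \<open>G\<close> inverts it through the inverse of \<open>?h\<close>.\<close>
  define F where "F = (\<lambda>(u, w). restrict (\<lambda>a. ?h (u a, w a)) V)"
  define G where "G v = (restrict (\<lambda>a. fst (inv_into (UNIV \<times> {0<..d}) ?h (v a))) V,
    restrict (\<lambda>a. snd (inv_into (UNIV \<times> {0<..d}) ?h (v a))) V)" for v :: "real^'n \<Rightarrow> real"
  have sumF: "(\<Sum>a\<in>V. F (u, w) a) = d * real (\<Sum>a\<in>V. u a) + (s * (\<Sum>a\<in>V. w a) + c * real (card V))" for u w
  proof -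
    have "(\<Sum>a\<in>V. F (u, w) a) = (\<Sum>a\<in>V. d * real (u a) + (s * w a + c))"
      by (rule sum.cong) (simp_all add: F_def)
    also have "\<dots> = d * real (\<Sum>a\<in>V. u a) + (s * (\<Sum>a\<in>V. w a) + c * real (card V))"
      by (simp add: sum.distrib sum_distrib_left)
    finally show ?thesis .
  qed
  \<comment> \<open>The two sums differ by the sign \<open>s\<close> and by the integral combination
    \<open>?q\<close> of the lattice points \<open>d *\<^sub>R a\<close>.\<close>
  have latF: "(\<Sum>a\<in>V. F (u, w) a *\<^sub>R a) \<in> int_lattice \<longleftrightarrow> (\<Sum>a\<in>V. w a *\<^sub>R a) \<in> int_lattice" for u w
  proof -
    let ?q = "\<Sum>a\<in>V. (real (u a) + c') *\<^sub>R (d *\<^sub>R a)"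
    have q: "?q \<in> int_lattice"
      by (rule int_lattice_sum, rule int_lattice_scaleR) (use d c in simp_all)
    have "(\<Sum>a\<in>V. F (u, w) a *\<^sub>R a) = (\<Sum>a\<in>V. s *\<^sub>R (w a *\<^sub>R a) + (real (u a) + c') *\<^sub>R (d *\<^sub>R a))"
      by (rule sum.cong) (simp_all add: F_def c algebra_simps)
    also have "\<dots> = s *\<^sub>R (\<Sum>a\<in>V. w a *\<^sub>R a) + ?q"
      by (simp add: sum.distrib scaleR_sum_right)
    finally have eq: "(\<Sum>a\<in>V. F (u, w) a *\<^sub>R a) = s *\<^sub>R (\<Sum>a\<in>V. w a *\<^sub>R a) + ?q" .
    have "s *\<^sub>R x + ?q \<in> int_lattice \<longleftrightarrow> s *\<^sub>R x \<in> int_lattice" for x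
      using int_lattice_diff[OF _ q, of "s *\<^sub>R x + ?q"] int_lattice_add[OF _ q, of "s *\<^sub>R x"] by auto
    moreover have "s *\<^sub>R x \<in> int_lattice \<longleftrightarrow> x \<in> int_lattice" for x :: "real^'n"
      using s int_lattice_minus_iff[of x] by auto
    ultimately show ?thesis unfolding eq by blast
  qed
  have hY: "?h p \<in> Y" if "p \<in> UNIV \<times> {0<..d}" for p
    using bij_betwE[OF bij] that by blast
  have invY: "inv_into (UNIV \<times> {0<..d}) ?h y \<in> UNIV \<times> {0<..d}"
    "?h (inv_into (UNIV \<times> {0<..d}) ?h y) = y" if "y \<in> Y" for y
    using bij_betw_imp_surj_on[OF bij] that by (auto intro: inv_into_into f_inv_into_f)
  have inv_h: "inv_into (UNIV \<times> {0<..d}) ?h (?h p) = p" if "p \<in> UNIV \<times> {0<..d}" for p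
    using inv_into_f_f[OF bij_betw_imp_inj_on[OF bij] that] .
  have FG: "F (G v) = v" if v: "v \<in> V \<rightarrow>\<^sub>E Y" for v
  proof
    fix a
    show "F (G v) a = v a"
    proof (cases "a \<in> V")
      case True
      then have "v a \<in> Y" using v by auto
      then show ?thesis using invY(2)[of "v a"] True
        by (simp add: F_def G_def split_beta)
    next
      case False
      then show ?thesis using PiE_arb[OF v] by (simp add: F_def G_def)
    qed
  qed
  have Gw: "snd (G v) \<in> V \<rightarrow>\<^sub>E {0<..d}" "fst (G v) \<in> V \<rightarrow>\<^sub>E UNIV" if v: "v \<in> V \<rightarrow>\<^sub>E Y" for v
  proof -
    have "snd (inv_into (UNIV \<times> {0<..d}) ?h (v a)) \<in> {0<..d}" if "a \<in> V" for a
    proof -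
      have "v a \<in> Y" using v that by auto
      from invY(1)[OF this] show ?thesis by (rule mem_Times_iff[THEN iffD1, THEN conjunct2])
    qed
    then show "snd (G v) \<in> V \<rightarrow>\<^sub>E {0<..d}" by (auto simp: G_def simp del: greaterThanAtMost_iff)
    show "fst (G v) \<in> V \<rightarrow>\<^sub>E UNIV" by (simp add: G_def)
  qed
  have GF: "G (F (u, w)) = (u, w)" if "w \<in> V \<rightarrow>\<^sub>E {0<..d}" "u \<in> V \<rightarrow>\<^sub>E UNIV" for u w
  proof -
    have "inv_into (UNIV \<times> {0<..d}) ?h (F (u, w) a) = (u a, w a)" if "a \<in> V" for a
    proof -
      have "(u a, w a) \<in> UNIV \<times> {0<..d}" using \<open>w \<in> _\<close> that by (auto simp: PiE_iff)
      from inv_h[OF this] show ?thesis using that by (simp add: F_def)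
    qed
    then have "G (F (u, w)) = (restrict u V, restrict w V)"
      unfolding G_def by (simp cong: restrict_cong)
    then show ?thesis using that PiE_restrict by metis
  qed
  \<comment> \<open>Through \<open>sumF\<close> and \<open>latF\<close> the disjoint pieces are
    described by conditions on \<open>F (u, w)\<close> alone, as the bijection requires.\<close>
  have Zmem: "(u, w) \<in> (\<Union>j\<in>J. Z j) \<longleftrightarrow> w \<in> V \<rightarrow>\<^sub>E {0<..d} \<and> u \<in> V \<rightarrow>\<^sub>E UNIV \<and>
      (\<Sum>a\<in>V. F (u, w) a) = t \<and> (\<Sum>a\<in>V. F (u, w) a *\<^sub>R a) \<in> int_lattice" for u w
  proof -
    have "(u, w) \<in> (\<Union>j\<in>J. Z j) \<longleftrightarrow> w \<in> V \<rightarrow>\<^sub>E {0<..d} \<and> u \<in> V \<rightarrow>\<^sub>E UNIV \<and>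
      (\<exists>j\<in>J. (\<Sum>a\<in>V. w a) = l j \<and> int (\<Sum>a\<in>V. u a) = K j) \<and> (\<Sum>a\<in>V. w a *\<^sub>R a) \<in> int_lattice"
      unfolding Z_def compositions_def lattice_weights_def by blast
    then show ?thesis unfolding sumF latF using level[of w u] by blast
  qed
  have Fmem: "F (u, w) \<in> V \<rightarrow>\<^sub>E Y" if "w \<in> V \<rightarrow>\<^sub>E {0<..d}" for u w
  proof -
    have "?h (u a, w a) \<in> Y" if "a \<in> V" for a
      by (rule hY) (use \<open>w \<in> _\<close> that in \<open>auto simp: PiE_iff\<close>)
    then show ?thesis by (simp add: F_def)
  qed
  have "bij_betw F (\<Union>j\<in>J. Z j) (lattice_weights V Y t)"
  proof (rule bij_betwI[where g = G])
    show "F \<in> (\<Union>j\<in>J. Z j) \<rightarrow> lattice_weights V Y t"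
    proof
      fix p assume p: "p \<in> (\<Union>j\<in>J. Z j)"
      obtain u w where "p = (u, w)" by (cases p)
      then show "F p \<in> lattice_weights V Y t"
        using p Zmem[of u w] Fmem[of w u] by (simp add: lattice_weights_def)
    qed
    show "G \<in> lattice_weights V Y t \<rightarrow> (\<Union>j\<in>J. Z j)"
    proof
      fix v assume v: "v \<in> lattice_weights V Y t"
      then have v': "v \<in> V \<rightarrow>\<^sub>E Y" by (simp add: lattice_weights_def)
      show "G v \<in> (\<Union>j\<in>J. Z j)"
        using Zmem[of "fst (G v)" "snd (G v)"] Gw[OF v'] FG[OF v'] v
        by (simp add: lattice_weights_def)
    qed
    show "G (F p) = p" if "p \<in> (\<Union>j\<in>J. Z j)" for p
    proof -
      obtain u w where "p = (u, w)" by (cases p)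
      then show ?thesis using that Zmem[of u w] GF[of w u] by simp
    qed
    show "F (G v) = v" if "v \<in> lattice_weights V Y t" for v
      using FG that by (simp add: lattice_weights_def)
  qed
  then have "card (lattice_weights V Y t) = card (\<Union>j\<in>J. Z j)"
    by (metis bij_betw_same_card)
  also have "\<dots> = (\<Sum>j\<in>J. card (Z j))"
  proof (rule card_UN_disjoint)
    show "\<forall>j\<in>J. finite (Z j)"
      using finite_compositions[OF fin] finite_lattice_weights[OF V, of "{0<..d}"]
      by (simp add: Z_def)
    show "\<forall>i\<in>J. \<forall>j\<in>J. i \<noteq> j \<longrightarrow> Z i \<inter> Z j = {}"
    proof (intro ballI impI)
      fix i j assume "i \<in> J" "j \<in> J" "i \<noteq> j"
      then have "l i \<noteq> l j" using \<open>inj_on l J\<close> by (auto dest: inj_onD)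
      then show "Z i \<inter> Z j = {}" by (auto simp: Z_def lattice_weights_def)
    qed
  qed (rule \<open>finite J\<close>)
  finally show ?thesis by (simp add: Z_def card_cartesian_product)
qed

text \<open>Remainders in (0, d] call for ceilings instead of floors. The form
  \<open>1 * w + 0\<close> is the instance \<open>s = 1\<close>, \<open>c = 0\<close> of the
  splitting.\<close>

lemma bij_betw_pos_remainder:
  fixes d :: real
  assumes "d > 0"
  shows "bij_betw (\<lambda>(k::nat, w). d * real k + (1 * w + 0)) (UNIV \<times> {0<..d}) {0<..}"
proof (rule bij_betwI[where g = "\<lambda>y. (nat (\<lceil>y / d\<rceil> - 1), y - d * of_int (\<lceil>y / d\<rceil> - 1))"])
  have ceil: "\<lceil>(d * real k + w) / d\<rceil> = int k + 1" if "0 < w" "w \<le> d" for k w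
  proof -
    have "(d * real k + w) / d = real k + w / d" "0 < w / d" "w / d \<le> 1"
      using assms that by (simp_all add: add_divide_distrib)
    then show ?thesis by (subst ceiling_eq_iff) auto
  qed
  show "(\<lambda>(k::nat, w). d * real k + (1 * w + 0)) \<in> UNIV \<times> {0<..d} \<rightarrow> {0<..}"
    using assms by (auto simp: add_nonneg_pos)
  show "(\<lambda>y. (nat (\<lceil>y / d\<rceil> - 1), y - d * of_int (\<lceil>y / d\<rceil> - 1))) \<in> {0<..} \<rightarrow> UNIV \<times> {0<..d}"
  proof
    fix y :: real assume y: "y \<in> {0<..}"
    have "of_int \<lceil>y / d\<rceil> - 1 < y / d" "y / d \<le> of_int \<lceil>y / d\<rceil>" by linarith+
    then have "(of_int \<lceil>y / d\<rceil> - 1) * d < y" "y \<le> of_int \<lceil>y / d\<rceil> * d"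
      by (simp_all only: pos_less_divide_eq[OF assms] pos_divide_le_eq[OF assms])
    then show "(nat (\<lceil>y / d\<rceil> - 1), y - d * of_int (\<lceil>y / d\<rceil> - 1)) \<in> UNIV \<times> {0<..d}"
      by (simp add: algebra_simps)
  qed
  show "(nat (\<lceil>(case p of (k, w) \<Rightarrow> d * real k + (1 * w + 0)) / d\<rceil> - 1),
      (case p of (k, w) \<Rightarrow> d * real k + (1 * w + 0)) - d * of_int (\<lceil>(case p of (k, w) \<Rightarrow> d * real k + (1 * w + 0)) / d\<rceil> - 1)) = p"
    if p: "p \<in> UNIV \<times> {0<..d}" for p
    using p ceil by (auto simp: algebra_simps)
  show "(case (nat (\<lceil>y / d\<rceil> - 1), y - d * of_int (\<lceil>y / d\<rceil> - 1)) of (k, w) \<Rightarrow> d * real k + (1 * w + 0)) = y"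
    if "y \<in> {0<..}" for y
  proof -
    have "y / d > 0" using that assms by simp
    then have "\<lceil>y / d\<rceil> \<ge> 1" by linarith
    then show ?thesis by simp
  qed
qed

text \<open>Here \<open>d - w\<close> runs through [0, d), the usual remainder, so the same
  \<open>w\<close> in (0, d] now parametrizes nonnegative numbers. This change of an endpoint turns
  open simplices into closed ones.\<close>

lemma bij_betw_nonneg_remainder:
  fixes d :: real
  assumes "d > 0"
  shows "bij_betw (\<lambda>(k::nat, w). d * real k + (- 1 * w + d)) (UNIV \<times> {0<..d}) {0..}"
proof (rule bij_betwI[where g = "\<lambda>y. (nat \<lfloor>y / d\<rfloor>, d + d * of_int \<lfloor>y / d\<rfloor> - y)"])
  have floor: "\<lfloor>(d * real k + (d - w)) / d\<rfloor> = int k" if "0 < w" "w \<le> d" for k w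
  proof -
    have "(d * real k + (d - w)) / d = real k + (1 - w / d)" "0 < w / d" "w / d \<le> 1"
      using assms that by (simp_all add: add_divide_distrib diff_divide_distrib)
    then show ?thesis by (subst floor_eq_iff) auto
  qed
  show "(\<lambda>(k::nat, w). d * real k + (- 1 * w + d)) \<in> UNIV \<times> {0<..d} \<rightarrow> {0..}"
    using assms by (auto intro!: add_nonneg_nonneg)
  show "(\<lambda>y. (nat \<lfloor>y / d\<rfloor>, d + d * of_int \<lfloor>y / d\<rfloor> - y)) \<in> {0..} \<rightarrow> UNIV \<times> {0<..d}"
  proof
    fix y :: real assume y: "y \<in> {0..}"
    have "of_int \<lfloor>y / d\<rfloor> \<le> y / d" "y / d < of_int \<lfloor>y / d\<rfloor> + 1" by linarith+
    then have "of_int \<lfloor>y / d\<rfloor> * d \<le> y" "y < (of_int \<lfloor>y / d\<rfloor> + 1) * d"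
      by (simp_all only: pos_le_divide_eq[OF assms] pos_divide_less_eq[OF assms])
    then show "(nat \<lfloor>y / d\<rfloor>, d + d * of_int \<lfloor>y / d\<rfloor> - y) \<in> UNIV \<times> {0<..d}"
      by (simp add: algebra_simps)
  qed
  show "(nat \<lfloor>(case p of (k, w) \<Rightarrow> d * real k + (- 1 * w + d)) / d\<rfloor>,
      d + d * of_int \<lfloor>(case p of (k, w) \<Rightarrow> d * real k + (- 1 * w + d)) / d\<rfloor> - (case p of (k, w) \<Rightarrow> d * real k + (- 1 * w + d))) = p"
    if p: "p \<in> UNIV \<times> {0<..d}" for p
  proof -
    obtain k w where kw: "p = (k, w)" "0 < w" "w \<le> d" using p by auto
    have "d * real k + (- 1 * w + d) = d * real k + (d - w)" by simp
    then show ?thesis using floor[OF kw(2,3), of k] kw(1) by (simp only: prod.case) simp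
  qed
  show "(case (nat \<lfloor>y / d\<rfloor>, d + d * of_int \<lfloor>y / d\<rfloor> - y) of (k, w) \<Rightarrow> d * real k + (- 1 * w + d)) = y"
    if "y \<in> {0..}" for y
    using that assms by simp
qed

text \<open>Origin of the range of \<open>j\<close> in the coefficient formula: n + 1 weights in (0,
  d] have a total in (0, (n + 1) d], and \<open>r\<close> in (-1, 0] leaves exactly these
  levels.\<close>

lemma weight_level_index:
  fixes w :: "'a \<Rightarrow> real"
  assumes "finite V" "card V = Suc n" "w \<in> V \<rightarrow>\<^sub>E {0<..d}" "d > 0" "- 1 < r" "r \<le> 0"
    and sum: "(\<Sum>a\<in>V. w a) = d * of_int p + d * r"
  shows "p \<in> int ` {1..n + 1}"
proof -
  have "V \<noteq> {}" using assms(2) by auto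
  have "0 < (\<Sum>a\<in>V. w a)"
    using assms(1,3) \<open>V \<noteq> {}\<close> by (intro sum_pos) (auto simp: PiE_iff)
  then have "0 < d * (of_int p + r)" by (simp add: sum algebra_simps)
  then have "p \<ge> 1" using assms(4,6) by (simp add: zero_less_mult_iff)
  have "(\<Sum>a\<in>V. w a) \<le> real (card V) * d"
    using assms(3) by (intro sum_bounded_above) (auto simp: PiE_iff)
  then have "d * (of_int p + r) \<le> d * (real n + 1)" by (simp add: sum assms(2) algebra_simps)
  then have "of_int p + r \<le> real n + 1" using assms(4) by simp
  then have "p \<le> int n + 1" using assms(5) by linarith
  then show ?thesis using \<open>p \<ge> 1\<close> by (intro image_eqI[of _ _ "nat p"]) auto
qed

lemma mult_eq_imp_eq_inverse_mult:
  fixes c f x y :: real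
  assumes "c * (f * x) = y" "f \<noteq> 0"
  shows "c * x = 1 / f * y"
  using assms(2) unfolding assms(1)[symmetric] by (simp add: field_simps)

section \<open>The number of weights with a given total\<close>

context
  fixes V :: "(real^'n) set" and n :: nat and d :: real
  assumes V: "\<not> affine_dependent V" "card V = Suc n"
    and d: "d > 0" "\<And>a. a \<in> V \<Longrightarrow> d *\<^sub>R a \<in> int_lattice"
begin

text \<open>With \<open>m = \<lceil>t / d\<rceil>\<close>, remainders at level \<open>j\<close>
  leave the sum m - j to the quotients. The number of compositions is a product in m - j, and m = t
  / d - r makes it a polynomial in t / d.\<close>

lemma card_pos_lattice_weights:
  assumes "t > 0"
  shows "real (card (lattice_weights V {0<..} t)) =
    1 / fact n * (\<Sum>j = 1..n + 1. real (card (lattice_weights V {0<..d} (d * real j + d * neg_frac (t / d)))) *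
      (\<Prod>i = 1..n. real i - real j - neg_frac (t / d) + t / d))"
proof -
  define m where "m = \<lceil>t / d\<rceil>"
  define r where "r = neg_frac (t / d)"
  have r: "- 1 < r" "r \<le> 0" using neg_frac_bounds by (auto simp: r_def)
  have td: "t / d = of_int m + r" by (simp add: m_def r_def neg_frac_def)
  have t: "t = d * of_int m + d * r" using td d(1) by (simp add: field_simps)
  have m: "m \<ge> 1" using assms d(1) by (simp add: m_def)
  have fin: "finite V" using V aff_independent_finite by blast
  have count: "card (lattice_weights V {0<..} t) = (\<Sum>j\<in>{1..n+1}. card (compositions V (m - int j)) *
    card (lattice_weights V {0<..d} (d * real j + d * r)))"
  proof (rule card_lattice_weights_split[OF V(1) d(2), where s = 1 and c = 0 and c' = 0])
    show "bij_betw (\<lambda>(k::nat, w). d * real k + (1 * w + 0)) (UNIV \<times> {0<..d}) {0<..}"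
      using bij_betw_pos_remainder[OF d(1)] .
    show "inj_on (\<lambda>j. d * real j + d * r) {1..n+1}" using d(1) by (auto simp: inj_on_def)
    fix u :: "real^'n \<Rightarrow> nat" and w assume w: "w \<in> V \<rightarrow>\<^sub>E {0<..d}"
    show "d * real (sum u V) + (1 * sum w V + 0 * real (card V)) = t \<longleftrightarrow>
      (\<exists>j\<in>{1..n+1}. sum w V = d * real j + d * r \<and> int (sum u V) = m - int j)"
    proof
      assume "d * real (sum u V) + (1 * sum w V + 0 * real (card V)) = t"
      then have sw: "sum w V = d * of_int (m - int (sum u V)) + d * r"
        using t by (simp add: algebra_simps del: of_nat_sum)
      obtain j where "m - int (sum u V) = int j" "j \<in> {1..n+1}"
        using weight_level_index[OF fin V(2) w d(1) r sw] by blast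
      then show "\<exists>j\<in>{1..n+1}. sum w V = d * real j + d * r \<and> int (sum u V) = m - int j"
        using sw by (intro bexI[of _ j]) (auto simp del: of_nat_sum)
    next
      assume "\<exists>j\<in>{1..n+1}. sum w V = d * real j + d * r \<and> int (sum u V) = m - int j"
      then obtain j where j: "sum w V = d * real j + d * r" "int (sum u V) = m - int j" by blast
      from arg_cong[OF j(2), of real_of_int] have su: "real (sum u V) = of_int m - real j"
        by (simp del: of_nat_sum)
      show "d * real (sum u V) + (1 * sum w V + 0 * real (card V)) = t"
        unfolding su j(1) t by (simp add: algebra_simps)
    qed
  qed (use d in auto)
  have "real (card (lattice_weights V {0<..} t)) = (\<Sum>j = 1..n + 1. 1 / fact n * (real (card (lattice_weights V {0<..d} (d * real j + d * r))) *
      (\<Prod>i = 1..n. real i - real j - r + t / d)))"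
    unfolding count of_nat_sum
  proof (rule sum.cong[OF refl])
    fix j assume j: "j \<in> {1..n+1}"
    have "fact n * real (card (compositions V (m - int j))) = (\<Prod>i = 1..n. of_int (m - int j) + real i)"
      \<comment> \<open>From \<open>m \<ge> 1\<close> and \<open>j \<le> n + 1\<close> follows m - j
        >= -n, the range in which the product formula still holds.\<close>
      using j m by (intro card_compositions[OF fin V(2)]) auto
    also have "\<dots> = (\<Prod>i = 1..n. real i - real j - r + t / d)"
      by (rule prod.cong) (auto simp: td)
    finally have "real (card (compositions V (m - int j))) = 1 / fact n * (\<Prod>i = 1..n. real i - real j - r + t / d)"
      using mult_eq_imp_eq_inverse_mult[OF trans[OF mult_1] fact_nonzero] by (simp only: mult_1)
    from arg_cong[OF this, of "\<lambda>x. x * real (card (lattice_weights V {0<..d} (d * real j + d * r)))"]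
    show "real (card (compositions V (m - int j)) * card (lattice_weights V {0<..d} (d * real j + d * r)))
      = 1 / fact n * (real (card (lattice_weights V {0<..d} (d * real j + d * r))) *
      (\<Prod>i = 1..n. real i - real j - r + t / d))"
      by (simp only: of_nat_mult mult_ac)
  qed
  then show ?thesis unfolding sum_distrib_left r_def .
qed

text \<open>Rounding is done at -t, so the levels are those of the formula evaluated at -t. Each of
  the n + 1 vertices contributes an extra \<open>d\<close>, whence the quotient sum j - m - (n +
  1).\<close>

lemma card_nonneg_lattice_weights:
  assumes "t \<ge> 0"
  shows "(- 1) ^ n * real (card (lattice_weights V {0..} t)) =
    1 / fact n * (\<Sum>j = 1..n + 1. real (card (lattice_weights V {0<..d} (d * real j + d * neg_frac (- t / d)))) *
      (\<Prod>i = 1..n. real i - real j - neg_frac (- t / d) + - t / d))"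
proof -
  define m where "m = \<lceil>- t / d\<rceil>"
  define r where "r = neg_frac (- t / d)"
  have r: "- 1 < r" "r \<le> 0" using neg_frac_bounds by (auto simp: r_def)
  have td: "- t / d = of_int m + r" by (simp add: m_def r_def neg_frac_def)
  have t: "- t = d * of_int m + d * r" using td d(1) by (simp add: field_simps)
  have m: "m \<le> 0" using assms d(1) by (simp add: m_def ceiling_le_zero)
  have fin: "finite V" using V aff_independent_finite by blast
  have count: "card (lattice_weights V {0..} t) = (\<Sum>j\<in>{1..n+1}. card (compositions V (int j - m - int (n + 1))) *
    card (lattice_weights V {0<..d} (d * real j + d * r)))"
  proof (rule card_lattice_weights_split[OF V(1) d(2), where s = "- 1" and c = d and c' = 1])
    show "bij_betw (\<lambda>(k::nat, w). d * real k + (- 1 * w + d)) (UNIV \<times> {0<..d}) {0..}"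
      using bij_betw_nonneg_remainder[OF d(1)] .
    show "inj_on (\<lambda>j. d * real j + d * r) {1..n+1}" using d(1) by (auto simp: inj_on_def)
    fix u :: "real^'n \<Rightarrow> nat" and w assume w: "w \<in> V \<rightarrow>\<^sub>E {0<..d}"
    show "d * real (sum u V) + (- 1 * sum w V + d * real (card V)) = t \<longleftrightarrow>
      (\<exists>j\<in>{1..n+1}. sum w V = d * real j + d * r \<and> int (sum u V) = int j - m - int (n + 1))"
    proof
      assume "d * real (sum u V) + (- 1 * sum w V + d * real (card V)) = t"
      then have sw: "sum w V = d * of_int (int (sum u V) + m + int (n + 1)) + d * r"
        using t V(2) by (simp add: algebra_simps del: of_nat_sum)
      obtain j where "int (sum u V) + m + int (n + 1) = int j" "j \<in> {1..n+1}"
        using weight_level_index[OF fin V(2) w d(1) r sw] by blast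
      then show "\<exists>j\<in>{1..n+1}. sum w V = d * real j + d * r \<and> int (sum u V) = int j - m - int (n + 1)"
        using sw by (intro bexI[of _ j]) (simp_all del: of_nat_sum)
    next
      assume "\<exists>j\<in>{1..n+1}. sum w V = d * real j + d * r \<and> int (sum u V) = int j - m - int (n + 1)"
      then obtain j where j: "sum w V = d * real j + d * r" "int (sum u V) = int j - m - int (n + 1)" by blast
      from arg_cong[OF j(2), of real_of_int] have su: "real (sum u V) = real j - of_int m - real (n + 1)"
        by (simp del: of_nat_sum)
      have "d * real (sum u V) + (- 1 * sum w V + d * real (card V)) = - (d * of_int m + d * r)"
        unfolding su j(1) V(2) by (simp add: algebra_simps)
      then show "d * real (sum u V) + (- 1 * sum w V + d * real (card V)) = t"
        using t by simp
    qed
  qed (use d in auto)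
  have "(- 1) ^ n * real (card (lattice_weights V {0..} t)) = (\<Sum>j = 1..n + 1. 1 / fact n * (real (card (lattice_weights V {0<..d} (d * real j + d * r))) *
      (\<Prod>i = 1..n. real i - real j - r + - t / d)))"
    unfolding count of_nat_sum sum_distrib_left
  proof (rule sum.cong[OF refl])
    fix j assume j: "j \<in> {1..n+1}"
    have "fact n * real (card (compositions V (int j - m - int (n + 1))))
      = (\<Prod>i = 1..n. of_int (int j - m - int (n + 1)) + real i)"
      \<comment> \<open>From \<open>m \<le> 0\<close> and \<open>j \<ge> 1\<close> the quotient sum
        is at least -n, again just within the admissible range.\<close>
      using j m by (intro card_compositions[OF fin V(2)]) auto
    \<comment> \<open>Reversing the factors prepares for taking -1 out of each: this is the source
      of the sign, and the remaining product is that of the positive case at -t.\<close>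
    also have "\<dots> = (\<Prod>i = 1..n. real j - of_int m - real i)"
      by (rule prod.reindex_bij_witness[of _ "\<lambda>i. n + 1 - i" "\<lambda>i. n + 1 - i"]) (auto simp: of_nat_diff)
    also have "\<dots> = (\<Prod>i = 1..n. - 1 * (real i - real j - r + - t / d))"
      unfolding td by (rule prod.cong) simp_all
    also have "\<dots> = (- 1) ^ n * (\<Prod>i = 1..n. real i - real j - r + - t / d)"
      by (subst prod.distrib) simp
    finally have "(- 1) ^ n * (fact n * real (card (compositions V (int j - m - int (n + 1)))))
      = (\<Prod>i = 1..n. real i - real j - r + - t / d)"
      by (simp only: left_minus_one_mult_self)
    then have "(- 1) ^ n * real (card (compositions V (int j - m - int (n + 1))))
      = 1 / fact n * (\<Prod>i = 1..n. real i - real j - r + - t / d)"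
      by (rule mult_eq_imp_eq_inverse_mult) simp
    from arg_cong[OF this, of "\<lambda>x. x * real (card (lattice_weights V {0<..d} (d * real j + d * r)))"]
    show "(- 1) ^ n * real (card (compositions V (int j - m - int (n + 1))) * card (lattice_weights V {0<..d} (d * real j + d * r)))
      = 1 / fact n * (real (card (lattice_weights V {0<..d} (d * real j + d * r))) *
      (\<Prod>i = 1..n. real i - real j - r + - t / d))"
      by (simp only: of_nat_mult mult_ac)
  qed
  then show ?thesis by (subst sum_distrib_left) (simp only: r_def)
qed

end

section \<open>The coefficient formula as a count of points of dilated simplices\<close>

lemma rational_simplexE:
  assumes "rational_simplex \<sigma>"
  obtains V where "\<not> affine_dependent V" "\<sigma> = convex hull V" "card V = Suc (nat (aff_dim \<sigma>))"
    "{a. a extreme_point_of \<sigma>} = V"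
proof -
  obtain k where k: "k simplex \<sigma>" and ne: "\<sigma> \<noteq> {}"
    using assms by (auto simp: rational_simplex_def rational_polytope_def)
  then obtain V where V: "\<not> affine_dependent V" "int (card V) = k + 1" "\<sigma> = convex hull V"
    by (auto simp: simplex_def)
  have "finite V" using V(1) aff_independent_finite by blast
  moreover have "V \<noteq> {}" using V(3) ne by auto
  ultimately have "card V > 0" by (simp add: card_gt_0_iff)
  then have "card V = Suc (nat (aff_dim \<sigma>))" using V(2) aff_dim_simplex[OF k] by linarith
  moreover have "{a. a extreme_point_of \<sigma>} = V"
    using V(1) by (simp add: V(3) extreme_point_of_convex_hull_affine_independent)
  ultimately show thesis using that V by blast
qed

text \<open>Passes from arbitrary weight functions to extensional ones, for which the weighted sum
  is injective.\<close>

lemma weighted_sum_image_restrict: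
  fixes V :: "(real^'n) set"
  shows "{\<Sum>a\<in>V. v a *\<^sub>R a | v. (\<forall>a\<in>V. v a \<in> Y) \<and> (\<Sum>a\<in>V. v a) = l}
    = (\<lambda>v. \<Sum>a\<in>V. v a *\<^sub>R a) ` {v \<in> V \<rightarrow>\<^sub>E Y. (\<Sum>a\<in>V. v a) = l}" (is "?A = ?B")
proof (intro equalityI subsetI)
  fix x assume "x \<in> ?A"
  then obtain v where v: "\<forall>a\<in>V. v a \<in> Y" "(\<Sum>a\<in>V. v a) = l" "x = (\<Sum>a\<in>V. v a *\<^sub>R a)" by blast
  have "(\<Sum>a\<in>V. restrict v V a) = l" "(\<Sum>a\<in>V. restrict v V a *\<^sub>R a) = x"
    using v by (simp_all cong: sum.cong)
  moreover have "restrict v V \<in> V \<rightarrow>\<^sub>E Y" using v(1) by simp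
  ultimately show "x \<in> ?B" by (intro image_eqI[of _ _ "restrict v V"]) simp_all
next
  fix x assume "x \<in> ?B"
  then obtain v where v: "v \<in> V \<rightarrow>\<^sub>E Y" "(\<Sum>a\<in>V. v a) = l" "x = (\<Sum>a\<in>V. v a *\<^sub>R a)" by blast
  then show "x \<in> ?A" by (intro CollectI exI[of _ v]) (auto simp: PiE_iff)
qed

lemma scaleR_rel_interior_simplex:
  fixes V :: "(real^'n) set"
  assumes "\<not> affine_dependent V" "t > 0"
  shows "(\<lambda>x. t *\<^sub>R x) ` rel_interior (convex hull V)
    = {\<Sum>a\<in>V. v a *\<^sub>R a | v. (\<forall>a\<in>V. v a \<in> {0<..}) \<and> (\<Sum>a\<in>V. v a) = t}" (is "?A = ?B")
proof (intro equalityI subsetI)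
  fix y assume "y \<in> ?A"
  then obtain u where u: "\<forall>a\<in>V. 0 < u a" "sum u V = 1" "y = t *\<^sub>R (\<Sum>a\<in>V. u a *\<^sub>R a)"
    unfolding rel_interior_convex_hull_explicit[OF assms(1)] by auto
  then show "y \<in> ?B" using assms(2)
    by (intro CollectI exI[of _ "\<lambda>a. t * u a"])
      (auto simp: scaleR_sum_right sum_distrib_left[symmetric])
next
  fix y assume "y \<in> ?B"
  then obtain v where v: "\<forall>a\<in>V. 0 < v a" "sum v V = t" "y = (\<Sum>a\<in>V. v a *\<^sub>R a)" by auto
  have "(\<Sum>a\<in>V. (v a / t) *\<^sub>R a) \<in> rel_interior (convex hull V)"
    unfolding rel_interior_convex_hull_explicit[OF assms(1)]
    using v assms(2) by (intro CollectI exI[of _ "\<lambda>a. v a / t"]) (auto simp: sum_divide_distrib[symmetric])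
  moreover have "y = t *\<^sub>R (\<Sum>a\<in>V. (v a / t) *\<^sub>R a)"
    using v(3) assms(2) by (simp add: scaleR_sum_right)
  ultimately show "y \<in> ?A" by blast
qed

lemma scaleR_convex_hull_finite:
  fixes V :: "(real^'n) set"
  assumes "finite V" "V \<noteq> {}" "t \<ge> 0"
  shows "(\<lambda>x. t *\<^sub>R x) ` (convex hull V)
    = {\<Sum>a\<in>V. v a *\<^sub>R a | v. (\<forall>a\<in>V. v a \<in> {0..}) \<and> (\<Sum>a\<in>V. v a) = t}" (is "?A = ?B")
proof (intro equalityI subsetI)
  fix y assume "y \<in> ?A"
  then obtain u where u: "\<forall>a\<in>V. 0 \<le> u a" "sum u V = 1" "y = t *\<^sub>R (\<Sum>a\<in>V. u a *\<^sub>R a)"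
    unfolding convex_hull_finite[OF assms(1)] by auto
  then show "y \<in> ?B" using assms(3)
    by (intro CollectI exI[of _ "\<lambda>a. t * u a"])
      (auto simp: scaleR_sum_right sum_distrib_left[symmetric])
next
  fix y assume "y \<in> ?B"
  then obtain v where v: "\<forall>a\<in>V. 0 \<le> v a" "sum v V = t" "y = (\<Sum>a\<in>V. v a *\<^sub>R a)" by auto
  show "y \<in> ?A"
  \<comment> \<open>Division by t is impossible at 0, but there nonnegative weights with total 0 all
    vanish.\<close>
  proof (cases "t = 0")
    case True
    then have "\<forall>a\<in>V. v a = 0" using v assms(1) by (simp add: sum_nonneg_eq_0_iff)
    then have "y = 0" using v(3) by simp
    obtain a where "a \<in> convex hull V" using assms(2) hull_inc[of _ V] by blast
    then show ?thesis using \<open>y = 0\<close> True by auto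
  next
    case False
    have "(\<Sum>a\<in>V. (v a / t) *\<^sub>R a) \<in> convex hull V"
      unfolding convex_hull_finite[OF assms(1)]
      using v assms(3) False by (intro CollectI exI[of _ "\<lambda>a. v a / t"]) (auto simp: sum_divide_distrib[symmetric])
    moreover have "y = t *\<^sub>R (\<Sum>a\<in>V. (v a / t) *\<^sub>R a)"
      using v(3) False by (simp add: scaleR_sum_right)
    ultimately show ?thesis by blast
  qed
qed

definition simplex_ehrhart :: "(real^'n) set \<Rightarrow> real \<Rightarrow> real" where
  "simplex_ehrhart \<sigma> t = (\<Sum>k = 0..nat (aff_dim \<sigma>). simplex_coeff \<sigma> k t * t ^ k)"

text \<open>The factor \<open>1 / d ^ k\<close> of the coefficient turns \<open>t ^ k\<close> into
  \<open>(t / d) ^ k\<close>; after exchanging the sums the generating function applies for each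
  \<open>j\<close>.\<close>

lemma simplex_ehrhart_eq_prod:
  fixes \<sigma> :: "(real^'n) set" and t :: real
  defines "n \<equiv> nat (aff_dim \<sigma>)" and "d \<equiv> polytope_denominator \<sigma>"
  shows "simplex_ehrhart \<sigma> t = 1 / fact n *
    (\<Sum>j = 1..n + 1. real (card (D_bar \<sigma> (d * real j + d * neg_frac (t / d)))) *
      (\<Prod>i = 1..n. real i - real j - neg_frac (t / d) + t / d))"
proof -
  let ?r = "neg_frac (t / d)"
  let ?N = "\<lambda>j. real (card (D_bar \<sigma> (d * real j + d * ?r)))"
  let ?e = "\<lambda>j k. elem_sym n (n - k) (\<lambda>i. real i - real j - ?r)"
  have "simplex_ehrhart \<sigma> t = (\<Sum>k = 0..n. \<Sum>j = 1..n + 1. 1 / fact n * (?N j * (?e j k * (t / d) ^ k)))"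
    unfolding simplex_ehrhart_def simplex_coeff_def Let_def n_def[symmetric] d_def[symmetric]
      sum_distrib_left sum_distrib_right
    by (intro sum.cong refl) (simp add: power_divide)
  also have "\<dots> = (\<Sum>j = 1..n + 1. \<Sum>k = 0..n. 1 / fact n * (?N j * (?e j k * (t / d) ^ k)))"
    by (rule sum.swap)
  also have "\<dots> = 1 / fact n * (\<Sum>j = 1..n + 1. ?N j * (\<Sum>k = 0..n. ?e j k * (t / d) ^ k))"
    by (simp only: sum_distrib_left)
  finally show ?thesis by (simp only: elem_sym_generating_function)
qed

lemma card_D_bar:
  fixes \<sigma> :: "(real^'n) set"
  assumes "\<not> affine_dependent V" "{a. a extreme_point_of \<sigma>} = V"
  shows "card (D_bar \<sigma> l) = card (lattice_weights V {0<..polytope_denominator \<sigma>} l)"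
proof -
  have ext: "a extreme_point_of \<sigma> \<longleftrightarrow> a \<in> V" for a using assms(2) by blast
  have "D_bar \<sigma> l = {\<Sum>a\<in>V. v a *\<^sub>R a | v.
      (\<forall>a\<in>V. v a \<in> {0<..polytope_denominator \<sigma>}) \<and> (\<Sum>a\<in>V. v a) = l} \<inter> int_lattice"
    unfolding D_bar_def ext by (simp add: Ball_def)
  then show ?thesis
    using card_lattice_weights_image[OF assms(1)] by (simp only: weighted_sum_image_restrict)
qed

theorem simplex_ehrhart_pos:
  fixes \<sigma> :: "(real^'n) set"
  assumes "rational_simplex \<sigma>" "t > 0"
  shows "simplex_ehrhart \<sigma> t = real (card ((\<lambda>x. t *\<^sub>R x) ` rel_interior \<sigma> \<inter> int_lattice))"
proof -
  obtain V where V: "\<not> affine_dependent V" "\<sigma> = convex hull V" "card V = Suc (nat (aff_dim \<sigma>))"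
    "{a. a extreme_point_of \<sigma>} = V"
    using assms(1) by (rule rational_simplexE)
  have rp: "rational_polytope \<sigma>" using assms(1) by (simp add: rational_simplex_def)
  have d: "a \<in> V \<Longrightarrow> polytope_denominator \<sigma> *\<^sub>R a \<in> int_lattice" for a
    using polytope_denominator_integral[OF rp] V(4) by blast
  have "card ((\<lambda>x. t *\<^sub>R x) ` rel_interior \<sigma> \<inter> int_lattice) = card (lattice_weights V {0<..} t)"
    unfolding V(2) scaleR_rel_interior_simplex[OF V(1) assms(2)] weighted_sum_image_restrict
    using card_lattice_weights_image[OF V(1)] .
  then show ?thesis
    using card_pos_lattice_weights[OF V(1,3) polytope_denominator_pos[OF rp] d assms(2)]
    by (simp only: simplex_ehrhart_eq_prod card_D_bar[OF V(1,4)])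
qed

text \<open>The product form at -t is the one counted by nonnegative weights. The case
  \<open>t = 0\<close> is included and provides the value of a cell at zero.\<close>

theorem simplex_ehrhart_reciprocity:
  fixes \<sigma> :: "(real^'n) set"
  assumes "rational_simplex \<sigma>" "t \<ge> 0"
  shows "simplex_ehrhart \<sigma> (- t) =
    (- 1) ^ nat (aff_dim \<sigma>) * real (card ((\<lambda>x. t *\<^sub>R x) ` \<sigma> \<inter> int_lattice))"
proof -
  obtain V where V: "\<not> affine_dependent V" "\<sigma> = convex hull V" "card V = Suc (nat (aff_dim \<sigma>))"
    "{a. a extreme_point_of \<sigma>} = V"
    using assms(1) by (rule rational_simplexE)
  have rp: "rational_polytope \<sigma>" using assms(1) by (simp add: rational_simplex_def)
  have d: "a \<in> V \<Longrightarrow> polytope_denominator \<sigma> *\<^sub>R a \<in> int_lattice" for a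
    using polytope_denominator_integral[OF rp] V(4) by blast
  have fin: "finite V" "V \<noteq> {}" using V(1,3) aff_independent_finite by (blast, auto)
  have "card ((\<lambda>x. t *\<^sub>R x) ` (convex hull V) \<inter> int_lattice) = card (lattice_weights V {0..} t)"
    unfolding scaleR_convex_hull_finite[OF fin assms(2)] weighted_sum_image_restrict
    using card_lattice_weights_image[OF V(1)] .
  then have "card ((\<lambda>x. t *\<^sub>R x) ` \<sigma> \<inter> int_lattice) = card (lattice_weights V {0..} t)"
    by (simp only: V(2)[symmetric])
  then show ?thesis
    using card_nonneg_lattice_weights[OF V(1,3) polytope_denominator_pos[OF rp] d assms(2)]
    by (simp only: simplex_ehrhart_eq_prod card_D_bar[OF V(1,4)])
qed

section \<open>Placing triangulations\<close>

text \<open>The visible points form the part of \<open>C\<close> over which cones with apex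
  \<open>v\<close> are erected when \<open>v\<close> is added to the triangulation.\<close>

definition visible_from :: "'a::euclidean_space \<Rightarrow> 'a set \<Rightarrow> 'a \<Rightarrow> bool" where
  "visible_from v C y \<longleftrightarrow> y \<in> C \<and> (\<forall>\<mu>. 0 < \<mu> \<and> \<mu> \<le> 1 \<longrightarrow> (1 - \<mu>) *\<^sub>R y + \<mu> *\<^sub>R v \<notin> C)"

text \<open>Makes visibility a property of whole cells. If the segment from \<open>y'\<close> to
  \<open>v\<close> met \<open>C\<close> again, prolonging the segment from \<open>y'\<close> to
  \<open>y\<close> slightly inside \<open>S\<close> and taking a convex combination would give a
  point of \<open>C\<close> on the segment from \<open>y\<close> to \<open>v\<close>.\<close>

lemma visible_from_rel_interior:
  assumes C: "convex C" "v \<notin> C" and S: "convex S" "S \<subseteq> C"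
    and y: "y \<in> rel_interior S" "y' \<in> rel_interior S"
    and vis: "visible_from v C y"
  shows "visible_from v C y'"
proof (rule ccontr)
  assume "\<not> visible_from v C y'"
  have yS: "y \<in> S" "y' \<in> S" using y rel_interior_subset by blast+
  then obtain \<mu> where \<mu>: "0 < \<mu>" "\<mu> \<le> 1" and z: "(1 - \<mu>) *\<^sub>R y' + \<mu> *\<^sub>R v \<in> C"
    using \<open>\<not> visible_from v C y'\<close> S(2) unfolding visible_from_def by blast
  have "\<mu> \<noteq> 1" using z C(2) by auto
  then have \<mu>1: "\<mu> < 1" using \<mu> by simp
  have "y' \<in> affine hull S" using yS(2) by (rule hull_inc)
  then obtain e where e: "e > 1" "(1 - e) *\<^sub>R y' + e *\<^sub>R y \<in> S"
    using convex_rel_interior_if2[OF S(1) y(1)] by blast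
  define \<delta> where "\<delta> = e - 1"
  \<comment> \<open>The weight for which \<open>y'\<close> drops out of the convex combination of
    the two points of \<open>C\<close>.\<close>
  define s where "s = \<delta> / (1 - \<mu> + \<delta>)"
  have \<delta>: "\<delta> > 0" using e by (simp add: \<delta>_def)
  have D: "1 - \<mu> + \<delta> > 0" using \<delta> \<mu>1 by simp
  have s: "0 < s" "s < 1" using \<delta> \<mu>1 D by (simp_all add: s_def)
  have sD: "s * (1 - \<mu> + \<delta>) = \<delta>" using D by (simp add: s_def)
  have q: "(- \<delta>) *\<^sub>R y' + (1 + \<delta>) *\<^sub>R y \<in> C" using e(2) S(2) by (auto simp: \<delta>_def)
  have "s *\<^sub>R ((1 - \<mu>) *\<^sub>R y' + \<mu> *\<^sub>R v) + (1 - s) *\<^sub>R ((- \<delta>) *\<^sub>R y' + (1 + \<delta>) *\<^sub>R y) \<in> C"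
    using C(1) z q s by (simp add: convexD)
  also have "s *\<^sub>R ((1 - \<mu>) *\<^sub>R y' + \<mu> *\<^sub>R v) + (1 - s) *\<^sub>R ((- \<delta>) *\<^sub>R y' + (1 + \<delta>) *\<^sub>R y)
    = (s * (1 - \<mu>) - (1 - s) * \<delta>) *\<^sub>R y' + ((1 - s) * (1 + \<delta>)) *\<^sub>R y + (s * \<mu>) *\<^sub>R v"
    by (simp add: algebra_simps)
  also have "s * (1 - \<mu>) - (1 - s) * \<delta> = 0"
    using sD by (simp add: algebra_simps)
  also have "(1 - s) * (1 + \<delta>) = 1 - s * \<mu>"
    using sD by (simp add: algebra_simps)
  finally have "(1 - s * \<mu>) *\<^sub>R y + (s * \<mu>) *\<^sub>R v \<in> C" by simp
  moreover have "0 < s * \<mu>" "s * \<mu> \<le> 1" using s \<mu> by (simp_all add: mult_le_one)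
  ultimately show False using vis unfolding visible_from_def by blast
qed

text \<open>Otherwise a relative interior point could be moved a little towards \<open>v\<close>
  within \<open>S\<close>. It follows that adding \<open>v\<close> to the vertices of a visible
  simplex keeps them affinely independent.\<close>

lemma visible_from_not_in_affine_hull:
  assumes S: "convex S" "S \<subseteq> C" and y: "y \<in> rel_interior S" and vis: "visible_from v C y"
  shows "v \<notin> affine hull S"
proof
  assume v: "v \<in> affine hull S"
  have yS: "y \<in> affine hull S" by (rule hull_inc[OF subsetD[OF rel_interior_subset y]])
  have "2 *\<^sub>R y + (- 1) *\<^sub>R v \<in> affine hull S"
    using mem_affine[OF affine_affine_hull yS v, of 2 "- 1"] by simp
  then obtain m where m: "m > 1" "\<forall>e. e > 1 \<and> e \<le> m \<longrightarrow> (1 - e) *\<^sub>R (2 *\<^sub>R y + (- 1) *\<^sub>R v) + e *\<^sub>R y \<in> S"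
    using convex_rel_interior_if[OF S(1) y] by blast
  \<comment> \<open>The step towards \<open>v\<close> has length \<open>e - 1\<close>; the cap 2
    keeps it within the parameters that visibility forbids.\<close>
  define e where "e = min m 2"
  have e: "e > 1" "e \<le> m" "e \<le> 2" using m(1) by (auto simp: e_def)
  have "(1 - e) *\<^sub>R (2 *\<^sub>R y + (- 1) *\<^sub>R v) + e *\<^sub>R y \<in> C" using m(2) e S(2) by blast
  also have "(1 - e) *\<^sub>R (2 *\<^sub>R y + (- 1) *\<^sub>R v) + e *\<^sub>R y
    = ((1 - e) * 2 + e) *\<^sub>R y + ((1 - e) * (- 1)) *\<^sub>R v"
    by (simp only: scaleR_add_right scaleR_add_left scaleR_scaleR add_ac)
  also have "(1 - e) * 2 + e = 1 - (e - 1)" by simp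
  also have "(1 - e) * (- 1) = e - 1" by simp
  finally have "(1 - (e - 1)) *\<^sub>R y + (e - 1) *\<^sub>R v \<in> C" .
  moreover have "0 < e - 1" "e - 1 \<le> 1" using e by simp_all
  ultimately show False using vis unfolding visible_from_def by blast
qed

text \<open>In barycentric coordinates \<open>\<mu>\<close> is the weight of the apex, and the other
  weights are divided by \<open>1 - \<mu>\<close>.\<close>

lemma rel_interior_convex_hull_insert:
  fixes S :: "'a::euclidean_space set"
  assumes ind: "\<not> affine_dependent (insert v S)" "v \<notin> S" "S \<noteq> {}"
  shows "rel_interior (convex hull (insert v S)) =
    {(1 - \<mu>) *\<^sub>R y + \<mu> *\<^sub>R v | y \<mu>. y \<in> rel_interior (convex hull S) \<and> 0 < \<mu> \<and> \<mu> < 1}" (is "?A = ?B")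
proof (intro equalityI subsetI)
  have ind': "\<not> affine_dependent S" using ind(1) affine_independent_subset by blast
  have fin: "finite S" using ind' aff_independent_finite by blast
  fix x
  {
    assume "x \<in> ?A"
    then obtain u where u: "\<forall>a\<in>insert v S. 0 < u a" "sum u (insert v S) = 1"
        "(\<Sum>a\<in>insert v S. u a *\<^sub>R a) = x"
      unfolding rel_interior_convex_hull_explicit[OF ind(1)] by auto
    have sum: "u v + sum u S = 1" "u v *\<^sub>R v + (\<Sum>a\<in>S. u a *\<^sub>R a) = x" using u fin ind(2) by auto
    have "sum u S > 0" using u(1) fin ind(3) by (intro sum_pos) auto
    then have \<mu>: "0 < u v" "u v < 1" using u(1) sum(1) by auto
    define y where "y = (\<Sum>a\<in>S. (u a / (1 - u v)) *\<^sub>R a)"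
    have "y \<in> rel_interior (convex hull S)"
      unfolding rel_interior_convex_hull_explicit[OF ind'] y_def
      using u(1) \<mu> sum(1)
      by (intro CollectI exI[of _ "\<lambda>a. u a / (1 - u v)"]) (auto simp: sum_divide_distrib[symmetric])
    moreover have "x = (1 - u v) *\<^sub>R y + u v *\<^sub>R v"
      using sum(2) \<mu> by (simp add: y_def scaleR_sum_right add.commute)
    ultimately show "x \<in> ?B" using \<mu> by blast
  next
    assume "x \<in> ?B"
    then obtain y \<mu> where y: "y \<in> rel_interior (convex hull S)" "0 < \<mu>" "\<mu> < 1"
      "x = (1 - \<mu>) *\<^sub>R y + \<mu> *\<^sub>R v" by blast
    then obtain u where u: "\<forall>a\<in>S. 0 < u a" "sum u S = 1" "(\<Sum>a\<in>S. u a *\<^sub>R a) = y"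
      unfolding rel_interior_convex_hull_explicit[OF ind'] by auto
    define w where "w a = (if a = v then \<mu> else (1 - \<mu>) * u a)" for a
    have "sum w S = (\<Sum>a\<in>S. (1 - \<mu>) * u a)" "(\<Sum>a\<in>S. w a *\<^sub>R a) = (\<Sum>a\<in>S. (1 - \<mu>) *\<^sub>R (u a *\<^sub>R a))"
      using ind(2) by (auto simp: w_def intro!: sum.cong)
    then have "sum w S = 1 - \<mu>" "(\<Sum>a\<in>S. w a *\<^sub>R a) = (1 - \<mu>) *\<^sub>R y"
      by (simp_all only: sum_distrib_left[symmetric] scaleR_sum_right[symmetric] u mult_1_right)
    moreover have "w v = \<mu>" by (simp add: w_def)
    ultimately have "sum w (insert v S) = 1" "(\<Sum>a\<in>insert v S. w a *\<^sub>R a) = x"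
      using fin ind(2) y(4) by auto
    moreover have "\<forall>a\<in>insert v S. 0 < w a" using u(1) y(2,3) by (auto simp: w_def)
    ultimately show "x \<in> ?A"
      unfolding rel_interior_convex_hull_explicit[OF ind(1)] by blast
  }
qed

text \<open>If \<open>\<mu>\<close> were smaller, \<open>y\<close> would lie on the segment from
  \<open>y'\<close> to \<open>v\<close> beyond \<open>y'\<close>, although it belongs to
  \<open>C\<close>.\<close>

lemma visible_from_ray_unique_le:
  assumes y: "visible_from v C y" "visible_from v C y'" and \<mu>: "\<mu> < 1" "\<mu>' < 1"
    and eq: "(1 - \<mu>) *\<^sub>R y + \<mu> *\<^sub>R v = (1 - \<mu>') *\<^sub>R y' + \<mu>' *\<^sub>R v"
  shows "\<mu>' \<le> \<mu>"
proof (rule ccontr)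
  assume "\<not> \<mu>' \<le> \<mu>"
  define \<nu> where "\<nu> = 1 - (1 - \<mu>') / (1 - \<mu>)"
  have \<nu>: "0 < \<nu>" "\<nu> \<le> 1" using \<mu> \<open>\<not> \<mu>' \<le> \<mu>\<close> by (simp_all add: \<nu>_def)
  have *: "(1 - \<mu>) * (1 - \<nu>) = 1 - \<mu>'" "(1 - \<mu>) * \<nu> = \<mu>' - \<mu>"
  proof -
    show "(1 - \<mu>) * (1 - \<nu>) = 1 - \<mu>'" using \<mu> by (simp add: \<nu>_def)
    then show "(1 - \<mu>) * \<nu> = \<mu>' - \<mu>" by (simp add: algebra_simps)
  qed
  have "(1 - \<mu>) *\<^sub>R ((1 - \<nu>) *\<^sub>R y' + \<nu> *\<^sub>R v) = (1 - \<mu>') *\<^sub>R y' + (\<mu>' - \<mu>) *\<^sub>R v"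
    by (simp only: scaleR_add_right scaleR_scaleR *)
  also have "\<dots> = (1 - \<mu>) *\<^sub>R y" using eq by (simp add: scaleR_left_diff_distrib algebra_simps)
  finally have "(1 - \<nu>) *\<^sub>R y' + \<nu> *\<^sub>R v = y" using \<mu> by simp
  then show False using y \<nu> unfolding visible_from_def by metis
qed

lemma visible_from_ray_unique:
  assumes y: "visible_from v C y" "visible_from v C y'" and \<mu>: "\<mu> < 1" "\<mu>' < 1"
    and eq: "(1 - \<mu>) *\<^sub>R y + \<mu> *\<^sub>R v = (1 - \<mu>') *\<^sub>R y' + \<mu>' *\<^sub>R v"
  shows "y = y'"
proof -
  have "\<mu> = \<mu>'"
    using visible_from_ray_unique_le[OF y \<mu> eq] visible_from_ray_unique_le[OF y(2,1) \<mu>(2,1) eq[symmetric]]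
    by simp
  then show ?thesis using eq \<mu> by simp
qed

text \<open>Among all segments from a point of \<open>C\<close> to \<open>v\<close> through
  \<open>x\<close>, one with the smallest parameter at \<open>x\<close> exists by compactness. Its
  starting point is the last point of \<open>C\<close> on the way to \<open>v\<close>.\<close>

lemma ex_visible_from:
  assumes C: "compact C" "convex C" "v \<notin> C"
    and x: "x \<in> convex hull (insert v C)" "x \<notin> C" "x \<noteq> v"
  obtains y \<mu> where "visible_from v C y" "0 < \<mu>" "\<mu> < 1" "x = (1 - \<mu>) *\<^sub>R y + \<mu> *\<^sub>R v"
proof -
  have "C \<noteq> {}" using x by auto
  define K where "K = ({0..1} \<times> C) \<inter> {p. (1 - fst p) *\<^sub>R snd p + fst p *\<^sub>R v = x}"
  have "closed {p :: real \<times> 'a. (1 - fst p) *\<^sub>R snd p + fst p *\<^sub>R v = x}"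
    by (intro closed_Collect_eq continuous_intros)
  then have "compact K" unfolding K_def using C(1) by (intro compact_Int_closed compact_Times) auto
  then have "compact (fst ` K)" by (intro compact_continuous_image continuous_intros)
  obtain u w b where ub: "u \<ge> 0" "w \<ge> 0" "u + w = 1" "b \<in> C" "x = u *\<^sub>R v + w *\<^sub>R b"
    using x(1) C(2) unfolding convex_hull_insert[OF \<open>C \<noteq> {}\<close>] by (auto simp: hull_same)
  have "w = 1 - u" using ub(3) by simp
  then have "(u, b) \<in> K" using ub by (simp add: K_def add.commute)
  then have "fst ` K \<noteq> {}" by auto
  then obtain \<mu> where \<mu>: "\<mu> \<in> fst ` K" "\<forall>\<mu>'\<in>fst ` K. \<mu> \<le> \<mu>'"
    using compact_attains_inf[OF \<open>compact (fst ` K)\<close>] by blast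
  then obtain y where y: "y \<in> C" "0 \<le> \<mu>" "\<mu> \<le> 1" "(1 - \<mu>) *\<^sub>R y + \<mu> *\<^sub>R v = x"
    by (auto simp: K_def)
  have "\<mu> \<noteq> 0" using y x(2) by auto
  moreover have "\<mu> \<noteq> 1" using y x(3) by auto
  ultimately have \<mu>01: "0 < \<mu>" "\<mu> < 1" using y by auto
  have "visible_from v C y"
    unfolding visible_from_def
  proof (intro conjI allI impI notI)
    fix \<nu> :: real assume \<nu>: "0 < \<nu> \<and> \<nu> \<le> 1" and z: "(1 - \<nu>) *\<^sub>R y + \<nu> *\<^sub>R v \<in> C"
    \<comment> \<open>A return to \<open>C\<close> at or after \<open>x\<close> would put
      \<open>x\<close> into \<open>C\<close> by convexity.\<close>
    have "\<nu> < \<mu>"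
    proof (rule ccontr)
      assume "\<not> \<nu> < \<mu>"
      then have s: "0 \<le> \<mu> / \<nu>" "\<mu> / \<nu> \<le> 1" using \<mu>01 \<nu> by simp_all
      have "(\<mu> / \<nu>) *\<^sub>R ((1 - \<nu>) *\<^sub>R y + \<nu> *\<^sub>R v) + (1 - \<mu> / \<nu>) *\<^sub>R y \<in> C"
        using convexD[OF C(2) z y(1)] s by simp
      also have "(\<mu> / \<nu>) *\<^sub>R ((1 - \<nu>) *\<^sub>R y + \<nu> *\<^sub>R v) + (1 - \<mu> / \<nu>) *\<^sub>R y
        = ((\<mu> / \<nu>) * (1 - \<nu>) + (1 - \<mu> / \<nu>)) *\<^sub>R y + ((\<mu> / \<nu>) * \<nu>) *\<^sub>R v"
        by (simp add: scaleR_add_right scaleR_add_left)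
      also have "(\<mu> / \<nu>) * (1 - \<nu>) + (1 - \<mu> / \<nu>) = 1 - \<mu>" using \<nu> by (simp add: field_simps)
      also have "(\<mu> / \<nu>) * \<nu> = \<mu>" using \<nu> by simp
      finally show False using y(4) x(2) by simp
    qed
    \<comment> \<open>The parameter of \<open>x\<close> on the shorter segment that starts at the
      point of \<open>C\<close> with parameter \<open>\<nu>\<close>; it contradicts
      minimality.\<close>
    define \<mu>' where "\<mu>' = 1 - (1 - \<mu>) / (1 - \<nu>)"
    have n1: "1 - \<nu> > 0" using \<open>\<nu> < \<mu>\<close> \<mu>01 by simp
    have \<mu>': "0 \<le> \<mu>'" "\<mu>' \<le> 1" "\<mu>' < \<mu>"
    proof -
      show "0 \<le> \<mu>'" "\<mu>' \<le> 1" using n1 \<open>\<nu> < \<mu>\<close> \<mu>01 by (simp_all add: \<mu>'_def)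
      have "(1 - \<mu>) * (1 - \<nu>) < 1 - \<mu>" using \<mu>01 \<nu> by (simp add: mult_less_cancel_left2)
      then have "1 - \<mu> < (1 - \<mu>) / (1 - \<nu>)" using n1 by (simp add: pos_less_divide_eq)
      then show "\<mu>' < \<mu>" by (simp add: \<mu>'_def)
    qed
    have *: "(1 - \<mu>') * (1 - \<nu>) = 1 - \<mu>" "(1 - \<mu>') * \<nu> + \<mu>' = \<mu>"
      proof -
      show "(1 - \<mu>') * (1 - \<nu>) = 1 - \<mu>" using n1 by (simp add: \<mu>'_def)
      then show "(1 - \<mu>') * \<nu> + \<mu>' = \<mu>" by (simp add: algebra_simps)
    qed
    have "(1 - \<mu>') *\<^sub>R ((1 - \<nu>) *\<^sub>R y + \<nu> *\<^sub>R v) + \<mu>' *\<^sub>R v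
      = ((1 - \<mu>') * (1 - \<nu>)) *\<^sub>R y + ((1 - \<mu>') * \<nu> + \<mu>') *\<^sub>R v"
      by (simp only: scaleR_add_right scaleR_add_left scaleR_scaleR add.assoc)
    then have "(1 - \<mu>') *\<^sub>R ((1 - \<nu>) *\<^sub>R y + \<nu> *\<^sub>R v) + \<mu>' *\<^sub>R v = x" using y(4) by (simp only: *)
    then have "(\<mu>', (1 - \<nu>) *\<^sub>R y + \<nu> *\<^sub>R v) \<in> K" using z \<mu>' by (simp add: K_def)
    then have "\<mu> \<le> \<mu>'" using \<mu>(2) by force
    then show False using \<mu>'(3) by simp
  qed (rule y(1))
  then show thesis using that \<mu>01 y(4) by blast
qed

text \<open>Points are placed one at a time. A point inside the current hull changes nothing; a
  point outside adds itself and the open cones over the visible cells. Every vertex is one of the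
  given points.\<close>

lemma placing_triangulation:
  fixes V :: "'a::euclidean_space set"
  assumes "finite V"
  shows "\<exists>F \<subseteq> Pow V. (\<forall>S\<in>F. S \<noteq> {} \<and> \<not> affine_dependent S) \<and>
    disjoint_family_on (\<lambda>S. rel_interior (convex hull S)) F \<and>
    (\<Union>S\<in>F. rel_interior (convex hull S)) = convex hull V"
  using assms
proof (induction V rule: finite_induct)
  case empty
  show ?case by (rule exI[of _ "{}"]) (simp add: disjoint_family_on_def)
next
  case (insert v V)
  let ?R = "\<lambda>S. rel_interior (convex hull S)"
  let ?C = "convex hull V"
  obtain F where F: "F \<subseteq> Pow V" "\<forall>S\<in>F. S \<noteq> {} \<and> \<not> affine_dependent S"
    "disjoint_family_on ?R F" "(\<Union>S\<in>F. ?R S) = ?C"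
    using insert.IH by (elim exE conjE)
  have hull_ins: "convex hull (insert v V) = convex hull (insert v ?C)"
    by (metis hull_insert)
  show ?case
  proof (cases "v \<in> ?C")
    case True
    then have "convex hull (insert v V) = ?C"
      unfolding hull_ins by (simp add: insert_absorb)
    then show ?thesis using F by (intro exI[of _ F]) auto
  next
    case False
    define W where "W = {S \<in> F. \<exists>y \<in> ?R S. visible_from v ?C y}"
    have compC: "compact ?C" using insert.hyps(1) finite_imp_compact_convex_hull by blast
    have subC: "convex hull S \<subseteq> ?C" if "S \<in> F" for S
      using that F(1) by (intro hull_mono) auto
    have RsubC: "?R S \<subseteq> ?C" if "S \<in> F" for S using F(4) that by blast
    have W_vis: "visible_from v ?C y" if "S \<in> W" "y \<in> ?R S" for S y
    proof -
      obtain y0 where "S \<in> F" "y0 \<in> ?R S" "visible_from v ?C y0" using \<open>S \<in> W\<close> by (auto simp: W_def)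
      then show ?thesis
        using visible_from_rel_interior[of ?C v "convex hull S" y0 y] False subC that(2) by simp
    qed
    have W_ind: "\<not> affine_dependent (insert v S)" "v \<notin> S" "S \<noteq> {}" if SW: "S \<in> W" for S
    proof -
      obtain y0 where y0: "S \<in> F" "y0 \<in> ?R S" "visible_from v ?C y0" using SW by (auto simp: W_def)
      have "v \<notin> affine hull (convex hull S)"
        using visible_from_not_in_affine_hull[of "convex hull S" ?C y0 v] y0 subC by simp
      then have v: "v \<notin> affine hull S" by simp
      then show "\<not> affine_dependent (insert v S)"
        using F(2) y0(1) affine_independent_insert by blast
      show "v \<notin> S" using v hull_inc[of v S affine] by blast
      show "S \<noteq> {}" using F(2) y0(1) by blast
    qed
    have R_ins: "x \<in> ?R (insert v S) \<longleftrightarrow> (\<exists>y \<mu>. y \<in> ?R S \<and> 0 < \<mu> \<and> \<mu> < 1 \<and> x = (1 - \<mu>) *\<^sub>R y + \<mu> *\<^sub>R v)"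
      if "S \<in> W" for S x
      unfolding rel_interior_convex_hull_insert[OF W_ind[OF that]] by blast
    \<comment> \<open>Invisible and visible old cells both stay: the open cones over
      \<open>W\<close> contain neither their base nor the apex, so \<open>{v}\<close> is added
      separately.\<close>
    define G where "G = insert {v} (F \<union> insert v ` W)"
    have Rv: "?R {v} = {v}" by simp
    have WF: "S \<in> W \<Longrightarrow> S \<in> F" for S by (simp add: W_def)
    have new_disj: "x \<notin> ?C \<and> x \<noteq> v" if S: "S \<in> W" "x \<in> ?R (insert v S)" for S x
    proof -
      obtain y \<mu> where y: "y \<in> ?R S" "0 < \<mu>" "\<mu> < 1" "x = (1 - \<mu>) *\<^sub>R y + \<mu> *\<^sub>R v"
        using S R_ins by blast
      have vis: "visible_from v ?C y" using W_vis S(1) y(1) by blast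
      then have "x \<notin> ?C" using y unfolding visible_from_def by simp
      moreover have "x \<noteq> v"
      proof
        assume "x = v"
        then have "(1 - \<mu>) *\<^sub>R y = (1 - \<mu>) *\<^sub>R v" using y(4) by (simp add: algebra_simps)
        then have "y = v" using y(3) by simp
        then show False using vis False by (simp add: visible_from_def)
      qed
      ultimately show ?thesis by blast
    qed
    \<comment> \<open>A point of an open cone determines its visible base point, and the old cells
      containing that base point are unique.\<close>
    have uniq: "S = S'" if S: "S \<in> W" "S' \<in> W" "x \<in> ?R (insert v S)" "x \<in> ?R (insert v S')" for S S' x
    proof -
      obtain y \<mu> where y: "y \<in> ?R S" "\<mu> < 1" "x = (1 - \<mu>) *\<^sub>R y + \<mu> *\<^sub>R v"
        using S R_ins by blast
      obtain y' \<mu>' where y': "y' \<in> ?R S'" "\<mu>' < 1" "x = (1 - \<mu>') *\<^sub>R y' + \<mu>' *\<^sub>R v"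
        using S R_ins by blast
      have "y = y'"
        using visible_from_ray_unique[OF W_vis[OF S(1) y(1)] W_vis[OF S(2) y'(1)] y(2) y'(2)] y(3) y'(3) by simp
      then show ?thesis using disjoint_family_onD[OF F(3) WF[OF S(1)] WF[OF S(2)]] y(1) y'(1) by blast
    qed
    have cover: "\<exists>S\<in>G. x \<in> ?R S" if x: "x \<in> convex hull (insert v V)" for x
    proof -
      consider "x = v" | "x \<in> ?C" | "x \<noteq> v" "x \<notin> ?C" by blast
      then show ?thesis
      proof cases
        case 1 then show ?thesis using Rv by (auto simp: G_def)
      next
        case 2 then show ?thesis using F(4) by (auto simp: G_def)
      next
        case 3
        obtain y \<mu> where y: "visible_from v ?C y" "0 < \<mu>" "\<mu> < 1" "x = (1 - \<mu>) *\<^sub>R y + \<mu> *\<^sub>R v"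
          using ex_visible_from[OF compC convex_convex_hull False _ 3(2,1)] x hull_ins by blast
        then have "y \<in> ?C" by (simp add: visible_from_def)
        then obtain S where S: "S \<in> F" "y \<in> ?R S" using F(4) by blast
        then have "S \<in> W" using y(1) by (auto simp: W_def)
        then have "x \<in> ?R (insert v S)" using R_ins S(2) y by blast
        then show ?thesis using \<open>S \<in> W\<close> by (auto simp: G_def)
      qed
    qed
    show ?thesis
    proof (intro exI[of _ G] conjI)
      show "G \<subseteq> Pow (insert v V)" using F(1) WF by (auto simp: G_def)
      show "\<forall>S\<in>G. S \<noteq> {} \<and> \<not> affine_dependent S"
        using F(2) W_ind by (auto simp: G_def)
      show "(\<Union>S\<in>G. ?R S) = convex hull (insert v V)"
      proof
        show "(\<Union>S\<in>G. ?R S) \<subseteq> convex hull (insert v V)"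
        proof (rule UN_least)
          fix S assume "S \<in> G"
          then have "S \<subseteq> insert v V" using F(1) WF by (auto simp: G_def)
          then have "convex hull S \<subseteq> convex hull (insert v V)" by (rule hull_mono)
          then show "?R S \<subseteq> convex hull (insert v V)" using rel_interior_subset by blast
        qed
        show "convex hull (insert v V) \<subseteq> (\<Union>S\<in>G. ?R S)" using cover by blast
      qed
      have "S = S'" if S: "S \<in> G" "S' \<in> G" "x \<in> ?R S" "x \<in> ?R S'" for S S' x
      proof -
        consider "S = {v}" "x = v" | "S \<in> F" "x \<in> ?C" | S0 where "S0 \<in> W" "S = insert v S0" "x \<notin> ?C" "x \<noteq> v"
          using S(1,3) Rv RsubC new_disj unfolding G_def by fastforce
        note c1 = this
        consider "S' = {v}" "x = v" | "S' \<in> F" "x \<in> ?C" | S0 where "S0 \<in> W" "S' = insert v S0" "x \<notin> ?C" "x \<noteq> v"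
          using S(2,4) Rv RsubC new_disj unfolding G_def by fastforce
        then show ?thesis
        proof cases
          case 1
          then show ?thesis using c1 False by (cases rule: c1) auto
        next
          case 2
          then show ?thesis using c1 False disjoint_family_onD[OF F(3), of S S'] S(3,4)
            by (cases rule: c1) auto
        next
          case (3 S0)
          then show ?thesis using uniq S(3,4) by (cases rule: c1) auto
        qed
      qed
      then show "disjoint_family_on ?R G" unfolding disjoint_family_on_def by blast
    qed
  qed
qed

section \<open>Reciprocity for decomposed polytopes\<close>

text \<open>Without new vertices, the denominator of \<open>P\<close> clears all vertices of all
  cells and is therefore a period of their coefficients.\<close>

lemma exists_vertex_decomposition:
  fixes P :: "(real^'n) set"
  assumes P: "rational_polytope P"
  obtains T where "open_simplex_decomposition T P"
    "\<And>\<sigma> a. \<sigma> \<in> T \<Longrightarrow> a extreme_point_of \<sigma> \<Longrightarrow> a extreme_point_of P"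
proof -
  have poly: "polytope P" using P by (simp add: rational_polytope_def)
  let ?V = "{a. a extreme_point_of P}"
  let ?R = "\<lambda>S. rel_interior (convex hull S)"
  obtain F where F: "F \<subseteq> Pow ?V" "\<forall>S\<in>F. S \<noteq> {} \<and> \<not> affine_dependent S"
    "disjoint_family_on ?R F" "(\<Union>S\<in>F. ?R S) = convex hull ?V"
    using placing_triangulation[OF polytope_finite_extreme_points[OF poly]] by (elim exE conjE)
  define T where "T = (hull) convex ` F"
  have ext: "a extreme_point_of (convex hull S) \<longleftrightarrow> a \<in> S" if "S \<in> F" for S a
    using F(2) that extreme_point_of_convex_hull_affine_independent by blast
  have rs: "rational_simplex (convex hull S)" if S: "S \<in> F" for S
  proof -
    have aff: "S \<noteq> {}" "\<not> affine_dependent S" using F(2) S by auto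
    then have "(int (card S) - 1) simplex (convex hull S)"
      by (intro simplex_convex_hull) simp
    moreover have "polytope (convex hull S)"
      using aff aff_independent_finite unfolding polytope_def by blast
    moreover have "a $ i \<in> \<rat>" if "a \<in> S" for a i
      using that S F(1) P unfolding rational_polytope_def by blast
    ultimately show ?thesis
      using aff ext[OF S] unfolding rational_simplex_def rational_polytope_def by auto
  qed
  have "disjoint_family_on rel_interior T"
    unfolding disjoint_family_on_def
  proof (intro ballI impI)
    fix \<sigma> \<tau> assume "\<sigma> \<in> T" "\<tau> \<in> T" "\<sigma> \<noteq> \<tau>"
    then obtain S S' where "S \<in> F" "S' \<in> F" "\<sigma> = convex hull S" "\<tau> = convex hull S'" "S \<noteq> S'"
      unfolding T_def by blast
    then show "rel_interior \<sigma> \<inter> rel_interior \<tau> = {}"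
      using disjoint_family_onD[OF F(3)] by simp
  qed
  moreover have "finite T"
    unfolding T_def using finite_subset[OF F(1)] polytope_finite_extreme_points[OF poly] by simp
  moreover have "(\<Union>\<sigma>\<in>T. rel_interior \<sigma>) = P"
    using F(4) convex_hull_extreme_points_polytope[OF poly] by (simp add: T_def)
  ultimately have "open_simplex_decomposition T P"
    using rs unfolding open_simplex_decomposition_def by (auto simp: T_def)
  then show thesis
    by (rule that) (use ext F(1) in \<open>auto simp: T_def\<close>)
qed

section \<open>Coefficients of quasi-polynomials\<close>

lemma ehrhart_coeff_periodic:
  assumes "\<And>\<sigma>. \<sigma> \<in> T \<Longrightarrow> rational_simplex \<sigma>"
    and "\<And>\<sigma> a. \<sigma> \<in> T \<Longrightarrow> a extreme_point_of \<sigma> \<Longrightarrow> e *\<^sub>R a \<in> int_lattice"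
  shows "ehrhart_coeff T k (t + e) = ehrhart_coeff T k t"
  unfolding ehrhart_coeff_def
  by (rule sum.cong[OF refl])
    (use assms in \<open>auto simp: rational_simplex_def intro!: simplex_coeff_periodic\<close>)

lemma ehrhart_coeff_sum_eq:
  fixes T :: "(real^'n) set set"
  assumes "finite T" "\<And>\<sigma>. \<sigma> \<in> T \<Longrightarrow> nat (aff_dim \<sigma>) \<le> N \<and> \<sigma> \<noteq> {}"
  shows "(\<Sum>k = 0..N. ehrhart_coeff T k t * t ^ k) = (\<Sum>\<sigma>\<in>T. simplex_ehrhart \<sigma> t)"
proof -
  have nonneg: "0 \<le> aff_dim \<sigma>" if "\<sigma> \<in> T" for \<sigma>
    using assms(2)[OF that] by (metis aff_dim_negative_iff not_less)
  have "(\<Sum>k = 0..N. ehrhart_coeff T k t * t ^ k)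
    = (\<Sum>k = 0..N. \<Sum>\<sigma>\<in>T. if int k \<le> aff_dim \<sigma> then simplex_coeff \<sigma> k t * t ^ k else 0)"
    unfolding ehrhart_coeff_def sum_distrib_right
    by (intro sum.cong refl sum.inter_filter[OF assms(1)])
  also have "\<dots> = (\<Sum>\<sigma>\<in>T. \<Sum>k = 0..N. if int k \<le> aff_dim \<sigma> then simplex_coeff \<sigma> k t * t ^ k else 0)"
    by (rule sum.swap)
  also have "\<dots> = (\<Sum>\<sigma>\<in>T. simplex_ehrhart \<sigma> t)"
  proof (rule sum.cong[OF refl])
    fix \<sigma> assume \<sigma>: "\<sigma> \<in> T"
    have "{k \<in> {0..N}. int k \<le> aff_dim \<sigma>} = {0..nat (aff_dim \<sigma>)}"
      using assms(2)[OF \<sigma>] nonneg[OF \<sigma>] by auto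
    then show "(\<Sum>k = 0..N. if int k \<le> aff_dim \<sigma> then simplex_coeff \<sigma> k t * t ^ k else 0) = simplex_ehrhart \<sigma> t"
      unfolding simplex_ehrhart_def by (subst sum.inter_filter[symmetric]) simp_all
  qed
  finally show ?thesis .
qed

text \<open>Along \<open>t + real m * D\<close> the coefficients are frozen at their values at
  \<open>t\<close>, so a polynomial with these coefficients has infinitely many roots. Vanishing at
  positive arguments thus controls all real ones.\<close>

lemma quasi_polynomial_coeffs_zero:
  fixes f :: "nat \<Rightarrow> real \<Rightarrow> real"
  assumes "D > 0" and per: "\<And>k t. f k (t + D) = f k t"
    and zero: "\<And>t. t > 0 \<Longrightarrow> (\<Sum>k = 0..N. f k t * t ^ k) = 0"
    and "k \<le> N"
  shows "f k t = 0"
proof (rule ccontr)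
  assume "f k t \<noteq> 0"
  have per': "f k (t + real m * D) = f k t" for k m
  proof (induction m)
    case (Suc m)
    have "t + real (Suc m) * D = (t + real m * D) + D" by (simp add: algebra_simps)
    then show ?case using per[of k "t + real m * D"] Suc by (simp only:)
  qed simp
  have "finite {x. (\<Sum>i\<le>N. f i t * x ^ i) = 0}"
    using polyfun_finite_roots[of "\<lambda>i. f i t" N] \<open>f k t \<noteq> 0\<close> \<open>k \<le> N\<close> by blast
  \<comment> \<open>From \<open>m0\<close> periods on, the shifted argument is positive even if
    \<open>t\<close> is not.\<close>
  moreover obtain m0 :: nat where m0: "real m0 * D > \<bar>t\<bar>"
    using reals_Archimedean3[OF \<open>D > 0\<close>] by blast
  have "(\<lambda>m. t + real m * D) ` {m0..} \<subseteq> {x. (\<Sum>i\<le>N. f i t * x ^ i) = 0}"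
  proof (rule image_subsetI)
    fix m assume "m \<in> {m0..}"
    then have "real m0 * D \<le> real m * D" using \<open>D > 0\<close> by simp
    then have "t + real m * D > 0" using m0 by linarith
    from zero[OF this] show "t + real m * D \<in> {x. (\<Sum>i\<le>N. f i t * x ^ i) = 0}"
      by (simp add: per' atMost_atLeast0)
  qed
  ultimately have "finite ((\<lambda>m. t + real m * D) ` {m0..})" by (metis finite_subset)
  then have "finite {m0..}"
    by (rule finite_imageD) (use \<open>D > 0\<close> in \<open>auto simp: inj_on_def\<close>)
  then show False using infinite_Ici by blast
qed

section \<open>Cell sums at positive, negative and zero arguments\<close>

lemma card_scaled_decomposition:
  fixes T :: "(real^'n) set set"
  assumes T: "finite T" "\<And>\<sigma>. \<sigma> \<in> T \<Longrightarrow> rational_simplex \<sigma>"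
    and disj: "disjoint_family_on rel_interior T" and "t > 0"
  shows "(\<Sum>\<sigma>\<in>T. simplex_ehrhart \<sigma> t) =
    real (card ((\<lambda>x. t *\<^sub>R x) ` (\<Union>\<sigma>\<in>T. rel_interior \<sigma>) \<inter> int_lattice))"
proof -
  let ?A = "\<lambda>\<sigma>. (\<lambda>x. t *\<^sub>R x) ` rel_interior \<sigma> \<inter> int_lattice"
  have "card (\<Union>\<sigma>\<in>T. ?A \<sigma>) = (\<Sum>\<sigma>\<in>T. card (?A \<sigma>))"
  proof (rule card_UN_disjoint)
    show "\<forall>\<sigma>\<in>T. finite (?A \<sigma>)"
    proof
      fix \<sigma> assume "\<sigma> \<in> T"
      then have "bounded \<sigma>"
        using T(2) by (auto simp: rational_simplex_def rational_polytope_def polytope_imp_bounded)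
      then have "bounded ((\<lambda>x. t *\<^sub>R x) ` rel_interior \<sigma>)"
        by (intro bounded_scaling) (rule bounded_subset[OF _ rel_interior_subset])
      then show "finite (?A \<sigma>)" by (rule finite_bounded_Int_int_lattice)
    qed
    show "\<forall>\<sigma>\<in>T. \<forall>\<tau>\<in>T. \<sigma> \<noteq> \<tau> \<longrightarrow> ?A \<sigma> \<inter> ?A \<tau> = {}"
    proof (intro ballI impI)
      fix \<sigma> \<tau> assume "\<sigma> \<in> T" "\<tau> \<in> T" "\<sigma> \<noteq> \<tau>"
      then have "rel_interior \<sigma> \<inter> rel_interior \<tau> = {}" using disjoint_family_onD[OF disj] by blast
      then show "?A \<sigma> \<inter> ?A \<tau> = {}" using \<open>t > 0\<close> by auto
    qed
  qed (rule T(1))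
  moreover have "(\<Union>\<sigma>\<in>T. ?A \<sigma>) = (\<lambda>x. t *\<^sub>R x) ` (\<Union>\<sigma>\<in>T. rel_interior \<sigma>) \<inter> int_lattice" by blast
  moreover have "(\<Sum>\<sigma>\<in>T. simplex_ehrhart \<sigma> t) = (\<Sum>\<sigma>\<in>T. real (card (?A \<sigma>)))"
    using simplex_ehrhart_pos[OF T(2) \<open>t > 0\<close>] by (intro sum.cong) auto
  ultimately show ?thesis by simp
qed

text \<open>Only the relative interior of \<open>P\<close> is decomposed, yet the closed cells reach
  the boundary: the local Euler relation holds at every point of \<open>P\<close>, so the whole
  closed polytope is counted.\<close>

lemma sum_simplex_ehrhart_neg:
  fixes P :: "(real^'n) set"
  assumes T: "finite T" "\<And>\<sigma>. \<sigma> \<in> T \<Longrightarrow> rational_simplex \<sigma> \<and> \<sigma> \<subseteq> P"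
    and disj: "disjoint_family_on rel_interior T"
    and un: "(\<Union>\<sigma>\<in>T. rel_interior \<sigma>) = rel_interior P"
    and P: "polytope P" "t > 0"
  shows "(\<Sum>\<sigma>\<in>T. simplex_ehrhart \<sigma> (- t)) =
    (- 1) ^ nat (aff_dim P) * real (card ((\<lambda>x. t *\<^sub>R x) ` P \<inter> int_lattice))"
proof -
  define X where "X = (\<lambda>x. t *\<^sub>R x) ` P \<inter> int_lattice"
  have finX: "finite X"
    unfolding X_def using P by (intro finite_bounded_Int_int_lattice bounded_scaling polytope_imp_bounded)
  have conv: "convex \<sigma> \<and> closed \<sigma>" if "\<sigma> \<in> T" for \<sigma>
    using T(2)[OF that] polytope_imp_convex polytope_imp_closed
    by (auto simp: rational_simplex_def rational_polytope_def)
  have mem: "x \<in> (\<lambda>x. t *\<^sub>R x) ` S \<longleftrightarrow> (1 / t) *\<^sub>R x \<in> S" for x :: "real^'n" and S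
    using P(2) by (auto simp: image_iff intro!: bexI[of _ "(1 / t) *\<^sub>R x"])
  have "(\<Sum>\<sigma>\<in>T. simplex_ehrhart \<sigma> (- t))
    = (\<Sum>\<sigma>\<in>T. \<Sum>x\<in>X. if (1 / t) *\<^sub>R x \<in> \<sigma> then (- 1) ^ nat (aff_dim \<sigma>) else 0)"
  proof (rule sum.cong[OF refl])
    fix \<sigma> assume \<sigma>: "\<sigma> \<in> T"
    have "(\<lambda>x. t *\<^sub>R x) ` \<sigma> \<inter> int_lattice = {x \<in> X. (1 / t) *\<^sub>R x \<in> \<sigma>}"
      using T(2)[OF \<sigma>] mem[of _ \<sigma>] mem[of _ P] unfolding X_def by blast
    then have "simplex_ehrhart \<sigma> (- t) = (- 1) ^ nat (aff_dim \<sigma>) * real (card {x \<in> X. (1 / t) *\<^sub>R x \<in> \<sigma>})"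
      using simplex_ehrhart_reciprocity[of \<sigma> t] T(2)[OF \<sigma>] P(2) by simp
    also have "\<dots> = (\<Sum>x\<in>{x \<in> X. (1 / t) *\<^sub>R x \<in> \<sigma>}. (- 1) ^ nat (aff_dim \<sigma>))"
      by simp
    also have "\<dots> = (\<Sum>x\<in>X. if (1 / t) *\<^sub>R x \<in> \<sigma> then (- 1) ^ nat (aff_dim \<sigma>) else 0)"
      by (rule sum.inter_filter[OF finX])
    finally show "simplex_ehrhart \<sigma> (- t) = (\<Sum>x\<in>X. if (1 / t) *\<^sub>R x \<in> \<sigma> then (- 1) ^ nat (aff_dim \<sigma>) else 0)" .
  qed
  also have "\<dots> = (\<Sum>x\<in>X. \<Sum>\<sigma>\<in>T. if (1 / t) *\<^sub>R x \<in> \<sigma> then (- 1) ^ nat (aff_dim \<sigma>) else 0)"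
    by (rule sum.swap)
  also have "\<dots> = (\<Sum>x\<in>X. (- 1) ^ nat (aff_dim P))"
  proof (rule sum.cong[OF refl])
    fix x assume "x \<in> X"
    then have "(1 / t) *\<^sub>R x \<in> P" by (simp add: X_def mem)
    from local_euler_relation[OF T(1) conv disj un polytope_imp_convex[OF P(1)] this]
    show "(\<Sum>\<sigma>\<in>T. if (1 / t) *\<^sub>R x \<in> \<sigma> then (- 1) ^ nat (aff_dim \<sigma>) else 0) = (- 1 :: real) ^ nat (aff_dim P)"
      by (subst sum.inter_filter[OF T(1), symmetric])
  qed
  finally show ?thesis by (simp add: X_def)
qed

text \<open>At zero each closed cell contains the single scaled point 0 and contributes its sign
  only, so the global Euler relation applies.\<close>

lemma sum_simplex_ehrhart_zero:
  fixes P :: "(real^'n) set"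
  assumes T: "finite T" "\<And>\<sigma>. \<sigma> \<in> T \<Longrightarrow> rational_simplex \<sigma>"
    and disj: "disjoint_family_on rel_interior T"
    and un: "(\<Union>\<sigma>\<in>T. rel_interior \<sigma>) = rel_interior P"
    and P: "polytope P" "P \<noteq> {}"
  shows "(\<Sum>\<sigma>\<in>T. simplex_ehrhart \<sigma> 0) = (- 1) ^ nat (aff_dim P)"
proof -
  have \<sigma>: "convex \<sigma> \<and> \<sigma> \<noteq> {}" if "\<sigma> \<in> T" for \<sigma>
    using T(2)[OF that] polytope_imp_convex by (auto simp: rational_simplex_def rational_polytope_def)
  have "simplex_ehrhart \<sigma> 0 = (- 1) ^ nat (aff_dim \<sigma>)" if "\<sigma> \<in> T" for \<sigma>
  proof -
    have "(\<lambda>x. 0 *\<^sub>R x) ` \<sigma> \<inter> int_lattice = {0}" using \<sigma>[OF that] zero_in_int_lattice by auto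
    then show ?thesis using simplex_ehrhart_reciprocity[OF T(2)[OF that], of 0] by simp
  qed
  then show ?thesis
    using global_euler_relation[OF T(1) \<sigma> disj un polytope_imp_convex[OF P(1)] polytope_imp_bounded[OF P(1)] P(2)]
    by simp
qed

definition interior_cells :: "(real^'n) set \<Rightarrow> (real^'n) set set \<Rightarrow> (real^'n) set set" where
  "interior_cells P T = {\<sigma> \<in> T. \<not> \<sigma> \<subseteq> rel_frontier P}"

section \<open>Reciprocity for one polytope with a fixed decomposition\<close>

context
  fixes P :: "(real^'n) set" and T :: "(real^'n) set set"
  assumes P: "rational_polytope P" and T: "open_simplex_decomposition T P"
begin

lemma rational_polytope_facts: "polytope P" "P \<noteq> {}" "convex P" "closed P"
  using P polytope_imp_convex polytope_imp_closed by (auto simp: rational_polytope_def)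

lemma decomposition_facts:
  "finite T" "\<sigma> \<in> T \<Longrightarrow> rational_simplex \<sigma>" "disjoint_family_on rel_interior T"
  "(\<Union>\<sigma>\<in>T. rel_interior \<sigma>) = P"
  using T by (auto simp: open_simplex_decomposition_def)

lemma cell_facts:
  assumes "\<sigma> \<in> T"
  shows "convex \<sigma>" "\<sigma> \<noteq> {}" "\<sigma> \<subseteq> P" "nat (aff_dim \<sigma>) \<le> nat (aff_dim P)"
proof -
  have \<sigma>: "polytope \<sigma>" "\<sigma> \<noteq> {}"
    using decomposition_facts(2)[OF assms] by (auto simp: rational_simplex_def rational_polytope_def)
  then show "convex \<sigma>" "\<sigma> \<noteq> {}" using polytope_imp_convex by auto
  \<comment> \<open>The decomposition places only the relative interior of a cell inside
    \<open>P\<close>; the cell itself follows because \<open>P\<close> is closed.\<close>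
  have "\<sigma> \<subseteq> closure \<sigma>" by (rule closure_subset)
  also have "\<dots> = closure (rel_interior \<sigma>)"
    using \<sigma>(1) by (simp add: convex_closure_rel_interior polytope_imp_convex)
  also have "\<dots> \<subseteq> P"
    using decomposition_facts(4) assms rational_polytope_facts(4) by (intro closure_minimal) auto
  finally show "\<sigma> \<subseteq> P" .
  then show "nat (aff_dim \<sigma>) \<le> nat (aff_dim P)" by (intro nat_mono aff_dim_subset)
qed

text \<open>A convex subset of \<open>P\<close> that is not contained in the relative frontier has
  its relative interior in that of \<open>P\<close>. Conversely, a cell through a relative interior
  point of \<open>P\<close> is not contained in the frontier.\<close>

lemma interior_cells_facts:
  "finite (interior_cells P T)" "\<sigma> \<in> interior_cells P T \<Longrightarrow> \<sigma> \<in> T" "disjoint_family_on rel_interior (interior_cells P T)"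
  "(\<Union>\<sigma>\<in>interior_cells P T. rel_interior \<sigma>) = rel_interior P"
proof -
  show "finite (interior_cells P T)" "\<sigma> \<in> interior_cells P T \<Longrightarrow> \<sigma> \<in> T"
    using decomposition_facts(1) by (auto simp: interior_cells_def)
  show "disjoint_family_on rel_interior (interior_cells P T)"
    using decomposition_facts(3) by (rule disjoint_family_on_mono[rotated]) (auto simp: interior_cells_def)
  have "rel_interior \<sigma> \<subseteq> rel_interior P" if "\<sigma> \<in> interior_cells P T" for \<sigma>
    using that cell_facts[of \<sigma>] rational_polytope_facts closure_subset[of P]
    by (intro subset_rel_interior_convex) (auto simp: interior_cells_def)
  moreover have "\<exists>\<sigma>\<in>interior_cells P T. x \<in> rel_interior \<sigma>" if x: "x \<in> rel_interior P" for x
  proof -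
    have "x \<in> P" using x rel_interior_subset by blast
    then obtain \<sigma> where \<sigma>: "\<sigma> \<in> T" "x \<in> rel_interior \<sigma>" using decomposition_facts(4) by blast
    then have "x \<in> \<sigma>" using rel_interior_subset by blast
    then have "\<not> \<sigma> \<subseteq> rel_frontier P" using x by (auto simp: rel_frontier_def)
    then show ?thesis using \<sigma> by (auto simp: interior_cells_def)
  qed
  ultimately show "(\<Union>\<sigma>\<in>interior_cells P T. rel_interior \<sigma>) = rel_interior P" by blast
qed

lemma ehrhart_eq_sum: "ehrhart P T t = (\<Sum>\<sigma>\<in>T. simplex_ehrhart \<sigma> t)"
  unfolding ehrhart_def using decomposition_facts(1) cell_facts by (intro ehrhart_coeff_sum_eq) auto

lemma ehrhart_int_eq_sum: "ehrhart_int P T t = (\<Sum>\<sigma>\<in>interior_cells P T. simplex_ehrhart \<sigma> t)"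
  unfolding ehrhart_int_def ehrhart_coeff_int_def interior_cells_def[symmetric]
  using interior_cells_facts(1,2) cell_facts by (intro ehrhart_coeff_sum_eq) auto

lemma ehrhart_pos:
  "t > 0 \<Longrightarrow> ehrhart P T t = real (card ((\<lambda>x. t *\<^sub>R x) ` P \<inter> int_lattice))"
  using card_scaled_decomposition[OF decomposition_facts(1,2,3)]
  by (simp add: ehrhart_eq_sum decomposition_facts(4))

lemma ehrhart_int_pos:
  "t > 0 \<Longrightarrow> ehrhart_int P T t = real (card ((\<lambda>x. t *\<^sub>R x) ` rel_interior P \<inter> int_lattice))"
  using card_scaled_decomposition[OF interior_cells_facts(1) decomposition_facts(2)[OF interior_cells_facts(2)] interior_cells_facts(3)]
  by (simp add: ehrhart_int_eq_sum interior_cells_facts(4))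

lemma ehrhart_int_neg:
  assumes "t > 0"
  shows "ehrhart_int P T (- t) = (- 1) ^ nat (aff_dim P) * ehrhart P T t"
proof -
  have "rational_simplex \<sigma> \<and> \<sigma> \<subseteq> P" if "\<sigma> \<in> interior_cells P T" for \<sigma>
    using interior_cells_facts(2)[OF that] decomposition_facts(2) cell_facts(3) by blast
  from sum_simplex_ehrhart_neg[OF interior_cells_facts(1) this interior_cells_facts(3,4) rational_polytope_facts(1) assms]
  show ?thesis by (simp add: ehrhart_int_eq_sum ehrhart_pos[OF assms])
qed

lemma ehrhart_int_zero: "ehrhart_int P T 0 = (- 1) ^ nat (aff_dim P)"
  unfolding ehrhart_int_eq_sum
  using sum_simplex_ehrhart_zero[OF interior_cells_facts(1) decomposition_facts(2)[OF interior_cells_facts(2)]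
    interior_cells_facts(3,4) rational_polytope_facts(1,2)] .

text \<open>A provisional period, possibly larger than the denominator of \<open>P\<close>, which
  suffices for comparing quasi-polynomials.\<close>

lemma ehrhart_coeff_common_period:
  obtains m :: nat where "m > 0" "\<And>\<sigma> a. \<sigma> \<in> T \<Longrightarrow> a extreme_point_of \<sigma> \<Longrightarrow> real m *\<^sub>R a \<in> int_lattice"
proof -
  let ?V = "\<Union>\<sigma>\<in>T. {a. a extreme_point_of \<sigma>}"
  have "rational_polytope \<sigma>" if "\<sigma> \<in> T" for \<sigma>
    using decomposition_facts(2)[OF that] by (simp add: rational_simplex_def)
  then have "finite ?V" "\<And>a i. a \<in> ?V \<Longrightarrow> a $ i \<in> \<rat>"
    using decomposition_facts(1) polytope_finite_extreme_points by (auto simp: rational_polytope_def)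
  from common_denominator[OF this] obtain m :: nat
    where "m > 0" "\<And>a. a \<in> ?V \<Longrightarrow> real m *\<^sub>R a \<in> int_lattice" by blast
  then show thesis by (intro that[of m]) auto
qed

lemma ehrhart_coeff_beyond_dim:
  assumes "k > nat (aff_dim P)" "T' \<subseteq> T"
  shows "ehrhart_coeff T' k t = 0"
proof -
  have "\<not> int k \<le> aff_dim \<sigma>" if "\<sigma> \<in> T'" for \<sigma>
    using cell_facts(4)[of \<sigma>] that assms by auto
  then have "{\<sigma>. \<sigma> \<in> T' \<and> int k \<le> aff_dim \<sigma>} = {}" by blast
  then show ?thesis unfolding ehrhart_coeff_def by (simp only: sum.empty)
qed

text \<open>Both sides are quasi-polynomials in \<open>t\<close> with a common period and agree for
  positive \<open>t\<close>, so their coefficient functions agree everywhere.\<close>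

lemma ehrhart_int_reciprocity:
  "ehrhart_int P T (- t) = (- 1) ^ nat (aff_dim P) * ehrhart P T t"
proof -
  let ?n = "nat (aff_dim P)"
  obtain m :: nat where m: "m > 0" "\<And>\<sigma> a. \<sigma> \<in> T \<Longrightarrow> a extreme_point_of \<sigma> \<Longrightarrow> real m *\<^sub>R a \<in> int_lattice"
    using ehrhart_coeff_common_period by blast
  \<comment> \<open>Coefficient functions of the difference of the two sides;
    \<open>(- 1) ^ k\<close> comes from the power of \<open>- t\<close>.\<close>
  define f where "f k t = ehrhart_coeff (interior_cells P T) k (- t) * (- 1) ^ k - (- 1) ^ ?n * ehrhart_coeff T k t" for k t
  have sum_f: "(\<Sum>k = 0..?n. f k t * t ^ k) = ehrhart_int P T (- t) - (- 1) ^ ?n * ehrhart P T t" for t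
  proof -
    have "f k t * t ^ k = ehrhart_coeff (interior_cells P T) k (- t) * (- t) ^ k - (- 1) ^ ?n * (ehrhart_coeff T k t * t ^ k)" for k
      by (simp add: f_def left_diff_distrib power_minus[of t] mult.assoc)
    then show ?thesis
      by (simp add: ehrhart_int_def ehrhart_def ehrhart_coeff_int_def interior_cells_def[symmetric]
        sum_subtractf sum_distrib_left)
  qed
  have "f k t = 0" if "k \<le> ?n" for k t
  proof (rule quasi_polynomial_coeffs_zero[where D = "real m" and f = f and N = ?n])
    fix k t
    \<comment> \<open>The reflected argument moves backwards, so periodicity is applied from
      \<open>- t - real m\<close>.\<close>
    have "ehrhart_coeff (interior_cells P T) k (- t - real m + real m) = ehrhart_coeff (interior_cells P T) k (- t - real m)"
      using decomposition_facts(2) interior_cells_facts(2) m(2) by (intro ehrhart_coeff_periodic) blast+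
    then have 1: "ehrhart_coeff (interior_cells P T) k (- (t + real m)) = ehrhart_coeff (interior_cells P T) k (- t)"
      by simp
    have "ehrhart_coeff T k (t + real m) = ehrhart_coeff T k t"
      using decomposition_facts(2) m(2) by (intro ehrhart_coeff_periodic) blast+
    with 1 show "f k (t + real m) = f k t" by (simp only: f_def)
  next
    fix t :: real assume "t > 0"
    then show "(\<Sum>k = 0..?n. f k t * t ^ k) = 0" using ehrhart_int_neg by (simp add: sum_f)
  qed (use m that in auto)
  then have "(\<Sum>k = 0..?n. f k t * t ^ k) = 0" by simp
  then show ?thesis using sum_f[of t] by simp
qed

text \<open>Counting cell by cell breaks down at 0, where all dilated cells coincide; the value
  comes from reciprocity at 0 and the value of the interior there.\<close>

lemma ehrhart_nonneg:
  assumes "t \<ge> 0"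
  shows "ehrhart P T t = real (card ((\<lambda>x. t *\<^sub>R x) ` P \<inter> int_lattice))"
proof (cases "t = 0")
  case True
  have "(- 1) ^ nat (aff_dim P) * ehrhart P T 0 = (- 1) ^ nat (aff_dim P)"
    using ehrhart_int_reciprocity[of 0] ehrhart_int_zero by simp
  then have "ehrhart P T 0 = 1" by simp
  moreover have "(\<lambda>x. 0 *\<^sub>R x) ` P \<inter> int_lattice = {0}" using rational_polytope_facts(2) zero_in_int_lattice by auto
  ultimately show ?thesis using True by simp
next
  case False
  then show ?thesis using ehrhart_pos assms by simp
qed

end

text \<open>Two decompositions of \<open>P\<close> count the same points, so they have the same coefficients.\<close>

lemma ehrhart_coeff_unique:
  fixes P :: "(real^'n) set"
  assumes P: "rational_polytope P"
    and T: "open_simplex_decomposition T P" "open_simplex_decomposition T' P"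
  shows "ehrhart_coeff T k t = ehrhart_coeff T' k t"
    and "ehrhart_coeff_int P T k t = ehrhart_coeff_int P T' k t"
proof -
  let ?n = "nat (aff_dim P)"
  obtain m :: nat where m: "m > 0" "\<And>\<sigma> a. \<sigma> \<in> T \<Longrightarrow> a extreme_point_of \<sigma> \<Longrightarrow> real m *\<^sub>R a \<in> int_lattice"
    using ehrhart_coeff_common_period[OF P T(1)] by blast
  obtain m' :: nat where m': "m' > 0" "\<And>\<sigma> a. \<sigma> \<in> T' \<Longrightarrow> a extreme_point_of \<sigma> \<Longrightarrow> real m' *\<^sub>R a \<in> int_lattice"
    using ehrhart_coeff_common_period[OF P T(2)] by blast
  define D where "D = real m * real m'"
  have D: "D > 0" using m(1) m'(1) by (simp add: D_def)
  have D1: "D *\<^sub>R a \<in> int_lattice" if "\<sigma> \<in> T" "a extreme_point_of \<sigma>" for \<sigma> a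
    using int_lattice_scaleR[OF m(2)[OF that], of "real m'"] by (simp add: D_def mult.commute)
  have D2: "D *\<^sub>R a \<in> int_lattice" if "\<sigma> \<in> T'" "a extreme_point_of \<sigma>" for \<sigma> a
    using int_lattice_scaleR[OF m'(2)[OF that], of "real m"] by (simp add: D_def)
  \<comment> \<open>Stated for subfamilies so as to serve both the full decompositions and their
    interior cells. Indices above the degree are treated separately, since comparing the sums says
    nothing about them.\<close>
  have coeffs: "ehrhart_coeff A k t = ehrhart_coeff A' k t"
    if A: "A \<subseteq> T" "A' \<subseteq> T'"
      and eq: "\<And>t. t > 0 \<Longrightarrow> (\<Sum>k = 0..?n. ehrhart_coeff A k t * t ^ k) = (\<Sum>k = 0..?n. ehrhart_coeff A' k t * t ^ k)"
    for A A'
  proof (cases "k \<le> ?n")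
    case True
    define f where "f k t = ehrhart_coeff A k t - ehrhart_coeff A' k t" for k t
    have "f k t = 0"
    proof (rule quasi_polynomial_coeffs_zero[where f = f and N = ?n, OF D _ _ True])
      fix k t
      have "ehrhart_coeff A k (t + D) = ehrhart_coeff A k t"
        using decomposition_facts(2)[OF P T(1)] D1 A(1) by (intro ehrhart_coeff_periodic) blast+
      moreover have "ehrhart_coeff A' k (t + D) = ehrhart_coeff A' k t"
        using decomposition_facts(2)[OF P T(2)] D2 A(2) by (intro ehrhart_coeff_periodic) blast+
      ultimately show "f k (t + D) = f k t" by (simp only: f_def)
    next
      fix t :: real assume "t > 0"
      from eq[OF this] show "(\<Sum>k = 0..?n. f k t * t ^ k) = 0"
        by (simp add: f_def left_diff_distrib sum_subtractf)
    qed
    then show ?thesis by (simp add: f_def)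
  next
    case False
    then show ?thesis
      using ehrhart_coeff_beyond_dim[OF P T(1) _ A(1)] ehrhart_coeff_beyond_dim[OF P T(2) _ A(2)] by simp
  qed
  show "ehrhart_coeff T k t = ehrhart_coeff T' k t"
  proof (rule coeffs)
    fix t :: real assume "t > 0"
    then show "(\<Sum>k = 0..?n. ehrhart_coeff T k t * t ^ k) = (\<Sum>k = 0..?n. ehrhart_coeff T' k t * t ^ k)"
      using ehrhart_pos[OF P T(1)] ehrhart_pos[OF P T(2)] by (simp add: ehrhart_def)
  qed simp_all
  show "ehrhart_coeff_int P T k t = ehrhart_coeff_int P T' k t"
    unfolding ehrhart_coeff_int_def
  proof (rule coeffs)
    fix t :: real assume "t > 0"
    then show "(\<Sum>k = 0..?n. ehrhart_coeff {\<sigma> \<in> T. \<not> \<sigma> \<subseteq> rel_frontier P} k t * t ^ k)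
      = (\<Sum>k = 0..?n. ehrhart_coeff {\<sigma> \<in> T'. \<not> \<sigma> \<subseteq> rel_frontier P} k t * t ^ k)"
      using ehrhart_int_pos[OF P T(1)] ehrhart_int_pos[OF P T(2)]
      by (simp add: ehrhart_int_def ehrhart_coeff_int_def)
  qed auto
qed

theorem theorem1p5:
  fixes P :: "(real^'n) set" and T :: "(real^'n) set set" and d :: real
  assumes "rational_polytope P"
    and "d = polytope_denominator P"
    and "open_simplex_decomposition T P"
  shows "(\<forall>k t. ehrhart_coeff T k (t + d) = ehrhart_coeff T k t) \<and>
    (\<forall>k t. ehrhart_coeff_int P T k (t + d) = ehrhart_coeff_int P T k t) \<and>
    (\<forall>t\<ge>0. ehrhart P T t = real (card ((\<lambda>x. t *\<^sub>R x) ` P \<inter> int_lattice))) \<and>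
    (\<forall>t>0. ehrhart_int P T t = real (card ((\<lambda>x. t *\<^sub>R x) ` rel_interior P \<inter> int_lattice))) \<and>
    (\<forall>t. ehrhart_int P T (- t) = (- 1) ^ nat (aff_dim P) * ehrhart P T t)"
proof -
  \<comment> \<open>The denominator of \<open>P\<close> need not clear the vertices of
    \<open>T\<close>. Periodicity is read off \<open>T0\<close> and carried over by uniqueness of
    the coefficients.\<close>
  obtain T0 where T0: "open_simplex_decomposition T0 P"
    "\<And>\<sigma> a. \<sigma> \<in> T0 \<Longrightarrow> a extreme_point_of \<sigma> \<Longrightarrow> a extreme_point_of P"
    using exists_vertex_decomposition[OF assms(1)] by blast
  have per: "d *\<^sub>R a \<in> int_lattice" if "\<sigma> \<in> T0" "a extreme_point_of \<sigma>" for \<sigma> a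
    using polytope_denominator_integral[OF assms(1) T0(2)[OF that]] assms(2) by simp
  have rs: "\<sigma> \<in> T0 \<Longrightarrow> rational_simplex \<sigma>" for \<sigma> by (rule decomposition_facts(2)[OF assms(1) T0(1)])
  have "ehrhart_coeff T k (t + d) = ehrhart_coeff T k t" for k t
    unfolding ehrhart_coeff_unique(1)[OF assms(1,3) T0(1)]
    by (rule ehrhart_coeff_periodic[OF rs per])
  moreover have "ehrhart_coeff_int P T k (t + d) = ehrhart_coeff_int P T k t" for k t
    unfolding ehrhart_coeff_unique(2)[OF assms(1,3) T0(1)]
    unfolding ehrhart_coeff_int_def by (rule ehrhart_coeff_periodic) (use rs per in auto)
  ultimately show ?thesis
    using ehrhart_nonneg[OF assms(1,3)] ehrhart_int_pos[OF assms(1,3)]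
      ehrhart_int_reciprocity[OF assms(1,3)] by blast
qed

end
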